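(* (i) Assume $d=2$. There are constants $a>0$ and $\kappa_2>0$ such that, for all $r$ large enough and for any configuration $\eta\in\mathbb{N}^{\mathbb{Z}^2}$ of explorers located outside $B(0,2r)$ (that is, $\eta(z)=0$ for all $z\in B(0,2r)$) with $|\eta|\le a\, r^2/\log^2 r$, the internal DLA cluster $A(\eta)$ satisfies $$P\big(0\in A(\eta)\big)\le \exp\Big(-\kappa_2\,\frac{r^2}{\log r}\Big).$$ (ii) Assume $d\ge 3$. There are constants $a>0$ and $\kappa_d>0$ such that, for all $r$ large enough and for any configuration $\eta\in\mathbb{N}^{\mathbb{Z}^d}$ of explorers located outside $B(0,2r)$ (that is, $\eta(z)=0$ for all $z\in B(0,2r)$) with $|\eta|\le a\, r^2/\log r$, the internal DLA cluster $A(\eta)$ satisfies $$P\big(0\in A(\eta)\big)\le \exp\big(-\kappa_d\, r^2\big).$$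
   Context: For $z\in\mathbb{R}^d$ and $\rho>0$, $B(z,\rho)=\{x\in\mathbb{Z}^d:\ \|x-z\|<\rho\}$ is the trace on $\mathbb{Z}^d$ of the Euclidean ball of center $z$ and radius $\rho$, where $\|\cdot\|$ is the Euclidean norm. A configuration is an element $\eta\in\mathbb{N}^{\mathbb{Z}^d}$, where $\mathbb{N}=\{0,1,2,\dots\}$ and $\eta(z)$ is the number of random walks initially at $z$; $|\eta|=\sum_{z\in\mathbb{Z}^d}\eta(z)$ is the total number of walks. Internal DLA: let $|\eta|<\infty$. Choose an arbitrary ordering of the $|\eta|$ walks. The cluster is initially empty (all sites are empty). Following the ordering, one at a time, run each walk as an independent simple symmetric nearest-neighbor random walk on $\mathbb{Z}^d$ started at its initial site. When the running walk is on an empty site (a site not yet in the cluster, possibly its initial site), it stops (settles) there, that site is added to the cluster, and then the next walk is sent. Walks following these settling rules are called explorers. The final cluster, after all walks have settled, is the random subset $A(\eta)\subset\mathbb{Z}^d$, which contains exactly $|\eta|$ sites; its law does not depend on the chosen ordering (abelian property). $P$ is the probability governing the walks. *)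

theory Defs
  imports "HOL-Probability.Probability"
begin

text \<open>The lattice \<open>\<int>\<^sup>d\<close> is the type \<open>int ^ 'd\<close> with \<open>d = CARD('d)\<close>.\<close>

definition lattice_embed :: "int ^ 'd \<Rightarrow> real ^ 'd" where
  "lattice_embed x = (\<chi> i. real_of_int (x $ i))"

definition lattice_ball :: "real ^ 'd \<Rightarrow> real \<Rightarrow> (int ^ 'd) set" where
  "lattice_ball z \<rho> = {x. norm (lattice_embed x - z) < \<rho>}"

definition unit_steps :: "(int ^ 'd) set" where
  "unit_steps = {axis i s | i s. s \<in> {1, -1}}"

definition step_sequences :: "(nat \<Rightarrow> int ^ 'd) measure" where
  "step_sequences = (\<Pi>\<^sub>M n\<in>UNIV. measure_pmf (pmf_of_set unit_steps))"

text \<open>In \<open>\<omega> j n\<close>, the index \<open>j\<close> numbers the walks and \<open>n\<close> the steps of a walk. The law provides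
  infinitely many independent walks, of which a configuration \<open>\<eta>\<close> uses the first \<open>|\<eta>|\<close>.\<close>

definition walks :: "(nat \<Rightarrow> nat \<Rightarrow> int ^ 'd) measure" where
  "walks = (\<Pi>\<^sub>M j\<in>UNIV. step_sequences)"

definition trajectory :: "int ^ 'd \<Rightarrow> (nat \<Rightarrow> int ^ 'd) \<Rightarrow> nat \<Rightarrow> int ^ 'd" where
  "trajectory x s n = x + (\<Sum>k<n. s k)"

text \<open>The \<open>else\<close> branch covers a walk that stays inside the finite cluster forever, which
  has probability zero.\<close>

definition settle :: "(int ^ 'd) set \<Rightarrow> (nat \<Rightarrow> int ^ 'd) \<Rightarrow> (int ^ 'd) set" where
  "settle A w = (if \<exists>n. w n \<notin> A then insert (w (LEAST n. w n \<notin> A)) A else A)"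

primrec idla_cluster_upto ::
    "(int ^ 'd) list \<Rightarrow> (nat \<Rightarrow> nat \<Rightarrow> int ^ 'd) \<Rightarrow> nat \<Rightarrow> (int ^ 'd) set" where
  "idla_cluster_upto xs \<omega> 0 = {}"
| "idla_cluster_upto xs \<omega> (Suc j) =
     settle (idla_cluster_upto xs \<omega> j) (trajectory (xs ! j) (\<omega> j))"

text \<open>Here \<open>xs\<close> lists the starting sites of the walks in the order in which they are sent.\<close>

definition idla_cluster ::
    "(int ^ 'd) list \<Rightarrow> (nat \<Rightarrow> nat \<Rightarrow> int ^ 'd) \<Rightarrow> (int ^ 'd) set" where
  "idla_cluster xs \<omega> = idla_cluster_upto xs \<omega> (length xs)"

definition finite_config :: "(int ^ 'd \<Rightarrow> nat) \<Rightarrow> bool" where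
  "finite_config \<eta> \<longleftrightarrow> finite {z. \<eta> z \<noteq> 0}"

definition config_size :: "(int ^ 'd \<Rightarrow> nat) \<Rightarrow> nat" where
  "config_size \<eta> = (\<Sum>z | \<eta> z \<noteq> 0. \<eta> z)"

definition walk_ordering :: "(int ^ 'd \<Rightarrow> nat) \<Rightarrow> (int ^ 'd) list \<Rightarrow> bool" where
  "walk_ordering \<eta> xs \<longleftrightarrow> (\<forall>z. count_list xs z = \<eta> z)"

text \<open>\<open>measure\<close> is zero on nonmeasurable sets, so the following facts are needed for
  probabilities of cluster events to be meaningful.\<close>

lemma prob_space_walks: "prob_space (walks :: (nat \<Rightarrow> nat \<Rightarrow> int ^ 'd) measure)"
  unfolding walks_def step_sequences_def
  by (intro prob_space_PiM) (simp_all add: measure_pmf.prob_space_axioms)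

lemma finite_idla_cluster_upto: "finite (idla_cluster_upto xs \<omega> j)"
  by (induction j) (auto simp: settle_def)

lemma measurable_trajectory:
  "(\<lambda>\<omega>. trajectory x (\<omega> j) n) \<in> walks \<rightarrow>\<^sub>M count_space (UNIV :: (int ^ 'd) set)"
proof (induction n)
  case 0
  then show ?case by (simp add: trajectory_def)
next
  case (Suc n)
  have "(\<lambda>\<omega>. \<omega> j) \<in> walks \<rightarrow>\<^sub>M (step_sequences :: (nat \<Rightarrow> int ^ 'd) measure)"
    unfolding walks_def by (rule measurable_component_singleton) simp
  moreover have "(\<lambda>s. s n) \<in> (step_sequences :: (nat \<Rightarrow> int ^ 'd) measure)
      \<rightarrow>\<^sub>M measure_pmf (pmf_of_set unit_steps)"
    unfolding step_sequences_def by (rule measurable_component_singleton) simp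
  ultimately have step: "(\<lambda>\<omega>. \<omega> j n) \<in> walks \<rightarrow>\<^sub>M count_space (UNIV :: (int ^ 'd) set)"
    by (auto dest: measurable_compose)
  have "(\<lambda>\<omega>. trajectory x (\<omega> j) n + \<omega> j n) \<in> walks \<rightarrow>\<^sub>M count_space (UNIV :: (int ^ 'd) set)"
  proof (rule measurable_compose_countable'[OF _ Suc.IH countableI_type])
    show "(\<lambda>\<omega>. y + \<omega> j n) \<in> walks \<rightarrow>\<^sub>M count_space UNIV" for y :: "int ^ 'd"
      using measurable_compose[OF step, of "\<lambda>z. y + z" "count_space UNIV"] by simp
  qed
  then show ?case by (simp add: trajectory_def add.assoc)
qed

lemma measurable_idla_cluster_upto:
  "(\<lambda>\<omega>. idla_cluster_upto xs \<omega> j)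
     \<in> walks \<rightarrow>\<^sub>M count_space (Collect finite :: (int ^ 'd) set set)"
proof (induction j)
  case 0
  then show ?case by simp
next
  case (Suc j)
  have cf: "countable (Collect finite :: (int ^ 'd) set set)"
    using countable_Collect_finite_subset[OF countableI_type, of UNIV] by simp
  have "(\<lambda>\<omega>. settle (idla_cluster_upto xs \<omega> j) (trajectory (xs ! j) (\<omega> j)))
     \<in> walks \<rightarrow>\<^sub>M count_space (Collect finite :: (int ^ 'd) set set)"
  proof (rule measurable_compose_countable'[OF _ Suc.IH cf])
    fix A :: "(int ^ 'd) set" assume "A \<in> Collect finite"
    then have A: "finite A" by simp
    let ?w = "\<lambda>\<omega>. trajectory (xs ! j) (\<omega> j)"
    have out: "Measurable.pred walks (\<lambda>\<omega>. ?w \<omega> n \<notin> A)" for n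
      using measurable_compose[OF measurable_trajectory, of "\<lambda>y. y \<notin> A" "count_space UNIV"]
      by simp
    then have exit: "(\<lambda>\<omega>. LEAST n. ?w \<omega> n \<notin> A) \<in> walks \<rightarrow>\<^sub>M count_space UNIV"
      by (rule measurable_Least)
    have site: "(\<lambda>\<omega>. ?w \<omega> (LEAST n. ?w \<omega> n \<notin> A)) \<in> walks \<rightarrow>\<^sub>M count_space UNIV"
      by (rule measurable_compose_countable[OF measurable_trajectory exit])
    have "(\<lambda>\<omega>. insert (?w \<omega> (LEAST n. ?w \<omega> n \<notin> A)) A)
        \<in> walks \<rightarrow>\<^sub>M count_space (Collect finite)"
      using measurable_compose[OF site, of "\<lambda>y. insert y A" "count_space (Collect finite)"] A
      by simp
    moreover have "Measurable.pred walks (\<lambda>\<omega>. \<exists>n. ?w \<omega> n \<notin> A)"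
      using out by measurable
    ultimately show "(\<lambda>\<omega>. settle A (?w \<omega>)) \<in> walks \<rightarrow>\<^sub>M count_space (Collect finite)"
      unfolding settle_def using A by (intro measurable_If) auto
  qed
  then show ?case by simp
qed

lemma sets_idla_cluster:
  "{\<omega> \<in> space walks. z \<in> idla_cluster xs \<omega>} \<in> sets walks"
proof -
  have "Measurable.pred walks (\<lambda>\<omega>. z \<in> idla_cluster xs \<omega>)"
    unfolding idla_cluster_def
    using measurable_compose[OF measurable_idla_cluster_upto,
        of "\<lambda>A. z \<in> A" "count_space UNIV"] by simp
  then show ?thesis by simp
qed

end

theory Submission
  imports Defs "HOL-Real_Asymp.Real_Asymp"
begin

text \<open>If \<open>N\<close> walks cover the origin, then the final cluster \<open>\<Lambda>\<close> meets all sup-norm spheres up to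
  radius of order \<open>r\<close>, and every walk reaches its settling site without leaving \<open>\<Lambda>\<close>. A walk settles
  within distance \<open>N\<close> of its start, so the settling sites can be prescribed in at most \<open>exp (C N log r)\<close>
  ways, and the bound on \<open>N\<close> makes this affordable. Once they are prescribed the walks are independent.
  Let \<open>n k\<close> be the number of sites of \<open>\<Lambda>\<close> on the sphere of radius \<open>k\<close>. A function supported on \<open>\<Lambda>\<close>
  satisfies a Poincare inequality on that sphere with constant of order \<open>n k ^ p\<close>, where \<open>p = 2\<close> in
  dimension two and \<open>p = 1\<close> above. By an Agmon estimate the probability to penetrate to the sphere of
  radius \<open>k\<close> is at most \<open>exp (- s k)\<close>, up to powers of \<open>r\<close>, where \<open>s k\<close> is the sum of
  \<open>n i powr (- p / 2)\<close> over the spheres \<open>i\<close> outside it. Filling \<open>\<Lambda>\<close> therefore costs the exponential of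
  the sum of \<open>n k * n i powr (- p / 2)\<close> over \<open>k < i\<close>. Whatever the counts \<open>n\<close> are, this sum has order at
  least \<open>r^2 / log r\<close> for \<open>p = 2\<close> (attained by exponentially growing counts) and \<open>r^2\<close> for \<open>p = 1\<close>.\<close>

section \<open>The lattice\<close>

text \<open>The spheres of this norm consist of flat faces, so they contain the coordinate segments
  and squares on which the discrete Sobolev inequalities are applied, and a walk cannot jump over a
  sphere.\<close>

definition sup_norm :: "int ^ 'd \<Rightarrow> nat" where
  "sup_norm z = Max (range (\<lambda>i. nat \<bar>z $ i\<bar>))"

lemma sup_norm_le_iff: "sup_norm z \<le> k \<longleftrightarrow> (\<forall>i. \<bar>z $ i\<bar> \<le> int k)"
  unfolding sup_norm_def by (subst Max_le_iff) (auto simp: nat_le_iff)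

lemma abs_le_sup_norm: "\<bar>z $ i\<bar> \<le> int (sup_norm z)"
  using sup_norm_le_iff by blast

lemma sup_norm_attained: obtains i where "\<bar>z $ i\<bar> = int (sup_norm z)"
proof -
  have "sup_norm z \<in> range (\<lambda>i. nat \<bar>z $ i\<bar>)"
    unfolding sup_norm_def by (rule Max_in) auto
  then show thesis using that by fastforce
qed

lemma sup_norm_eqI:
  assumes "\<And>i. \<bar>z $ i\<bar> \<le> int k" and "\<bar>z $ i\<bar> = int k"
  shows "sup_norm z = k"
  using assms abs_le_sup_norm[of z i] by (intro antisym) (auto simp: sup_norm_le_iff)

lemma sup_norm_0 [simp]: "sup_norm 0 = 0"
  by (rule sup_norm_eqI) auto

lemma vec_lambda_image_cube:
  "{z :: int ^ 'd. sup_norm z \<le> R} = vec_lambda ` (UNIV \<rightarrow>\<^sub>E {- int R..int R})"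
proof (intro set_eqI iffI)
  fix z :: "int ^ 'd" assume "z \<in> {z. sup_norm z \<le> R}"
  then have "vec_nth z \<in> UNIV \<rightarrow>\<^sub>E {- int R..int R}" by (auto simp: sup_norm_le_iff abs_le_iff) (smt (verit))
  then show "z \<in> vec_lambda ` (UNIV \<rightarrow>\<^sub>E {- int R..int R})"
    by (metis image_eqI vec_nth_inverse)
next
  fix z :: "int ^ 'd" assume "z \<in> vec_lambda ` (UNIV \<rightarrow>\<^sub>E {- int R..int R})"
  then obtain f where f: "f \<in> UNIV \<rightarrow>\<^sub>E {- int R..int R}" "z = vec_lambda f" by blast
  then have "f i \<in> {- int R..int R}" for i by auto
  then show "z \<in> {z. sup_norm z \<le> R}" by (auto simp: f sup_norm_le_iff abs_le_iff minus_le_iff)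
qed

lemma finite_sup_ball [simp]: "finite {z :: int ^ 'd. sup_norm z \<le> R}"
  unfolding vec_lambda_image_cube by (intro finite_imageI finite_PiE) auto

lemma card_sup_ball_le: "card {z :: int ^ 'd. sup_norm z \<le> R} \<le> (2 * R + 1) ^ CARD('d)"
proof -
  have "card {z :: int ^ 'd. sup_norm z \<le> R} \<le> card ((UNIV :: 'd set) \<rightarrow>\<^sub>E {- int R..int R})"
    unfolding vec_lambda_image_cube by (intro card_image_le finite_PiE) auto
  then show ?thesis by (simp add: card_PiE nat_add_distrib nat_mult_distrib mult.commute)
qed

lemma unit_steps_eq: "unit_steps = (\<lambda>(i, s). axis i s) ` (UNIV \<times> {1, -1})"
  by (auto simp: unit_steps_def)

lemma finite_unit_steps [simp]: "finite (unit_steps :: (int ^ 'd) set)"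
  unfolding unit_steps_eq by simp

lemma card_unit_steps: "card (unit_steps :: (int ^ 'd) set) = 2 * CARD('d)"
proof -
  have "inj_on (\<lambda>(i, s). axis i s :: int ^ 'd) (UNIV \<times> {1, -1})"
    by (auto simp: inj_on_def axis_eq_axis)
  then show ?thesis unfolding unit_steps_eq by (simp add: card_image)
qed

lemma unit_steps_nonempty [simp]: "(unit_steps :: (int ^ 'd) set) \<noteq> {}"
  by (auto simp: unit_steps_def)

lemma uminus_unit_steps: "e \<in> unit_steps \<Longrightarrow> - e \<in> unit_steps" for e :: "int ^ 'd"
proof -
  have "- axis i s = (axis i (- s) :: int ^ 'd)" for i s by (simp add: vec_eq_iff axis_def)
  then show "e \<in> unit_steps \<Longrightarrow> - e \<in> unit_steps" by (force simp: unit_steps_def)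
qed

lemma axis_in_unit_steps [simp]: "axis i 1 \<in> unit_steps" "axis i (-1) \<in> unit_steps"
  by (auto simp: unit_steps_def)

lemma unit_step_component: "e \<in> unit_steps \<Longrightarrow> \<bar>e $ i\<bar> \<le> 1"
  by (auto simp: unit_steps_def axis_def)

lemma sup_norm_unit_step:
  assumes "e \<in> unit_steps" shows "sup_norm (z + e) \<le> Suc (sup_norm z)"
proof -
  have "\<bar>(z + e) $ i\<bar> \<le> int (Suc (sup_norm z))" for i
    using abs_le_sup_norm[of z i] unit_step_component[OF assms, of i] by simp
  then show ?thesis by (simp add: sup_norm_le_iff)
qed

definition adjacent :: "int ^ 'd \<Rightarrow> int ^ 'd \<Rightarrow> bool" where
  "adjacent z z' \<longleftrightarrow> z' - z \<in> unit_steps"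

lemma adjacent_sym: "adjacent z z' \<longleftrightarrow> adjacent z' z"
  using uminus_unit_steps[of "z' - z"] uminus_unit_steps[of "z - z'"] by (auto simp: adjacent_def)

lemma adjacent_sup_norm:
  assumes "adjacent z z'" shows "sup_norm z' \<le> Suc (sup_norm z)"
  using sup_norm_unit_step[of "z' - z" z] assms by (simp add: adjacent_def)

lemma Collect_adjacent: "{z'. adjacent z z'} = (\<lambda>e. z + e) ` unit_steps"
  by (force simp: adjacent_def image_iff)

lemma finite_adjacent [simp]: "finite {z'. adjacent z z'}"
  by (simp add: Collect_adjacent)

lemma card_adjacent: "card {z'. adjacent (z :: int ^ 'd) z'} = 2 * CARD('d)"
  by (simp add: Collect_adjacent card_image card_unit_steps)

lemma sum_adjacent: "(\<Sum>z' | adjacent z z'. f z') = (\<Sum>e\<in>unit_steps. f (z + e))"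
  unfolding Collect_adjacent by (subst sum.reindex) auto

section \<open>Poincare inequalities on shells\<close>

lemma variation_bound:
  fixes f :: "int \<Rightarrow> real"
  assumes "t0 \<in> {a..b}" "t \<in> {a..b}" "f t0 = 0"
  shows "\<bar>f t\<bar> \<le> (\<Sum>u\<in>{a..<b}. \<bar>f (u + 1) - f u\<bar>)"
proof -
  have tele: "\<bar>f q - f p\<bar> \<le> (\<Sum>u\<in>{p..<q}. \<bar>f (u + 1) - f u\<bar>)" if "p \<le> q" for p q
    using that
  proof (induction q rule: int_ge_induct)
    case (step q)
    have "{p..<q + 1} = insert q {p..<q}" using step.hyps by auto
    then show ?case using step.IH by simp
  qed simp
  have mono: "(\<Sum>u\<in>{p..<q}. \<bar>f (u + 1) - f u\<bar>) \<le> (\<Sum>u\<in>{a..<b}. \<bar>f (u + 1) - f u\<bar>)"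
    if "a \<le> p" "q \<le> b" for p q
    using that by (intro sum_mono2) auto
  show ?thesis
  proof (cases "t0 \<le> t")
    case True
    then show ?thesis using tele[of t0 t] mono[of t0 t] assms by simp
  next
    case False
    then show ?thesis using tele[of t t0] mono[of t t0] assms by simp
  qed
qed

text \<open>Cauchy-Schwarz against the indicator of the support. In this way the number of cluster
  sites on a sphere, rather than the size of the sphere, enters the Poincare constants.\<close>

lemma sum_abs_squared_le:
  fixes f :: "'a \<Rightarrow> real"
  assumes "finite A" and "card {x \<in> A. f x \<noteq> 0} \<le> m"
  shows "(\<Sum>x\<in>A. \<bar>f x\<bar>)\<^sup>2 \<le> real m * (\<Sum>x\<in>A. (f x)\<^sup>2)"
proof -
  let ?S = "{x \<in> A. f x \<noteq> 0}"
  have eq: "(\<Sum>x\<in>A. \<bar>f x\<bar>) = (\<Sum>x\<in>?S. \<bar>f x\<bar>)" "(\<Sum>x\<in>A. (f x)\<^sup>2) = (\<Sum>x\<in>?S. (f x)\<^sup>2)"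
    using assms by (auto intro!: sum.mono_neutral_right)
  have "(\<Sum>x\<in>?S. \<bar>f x\<bar> * 1)\<^sup>2 \<le> (\<Sum>x\<in>?S. \<bar>f x\<bar>\<^sup>2) * (\<Sum>x\<in>?S. 1\<^sup>2)"
    by (rule Cauchy_Schwarz_ineq_sum)
  also have "\<dots> \<le> (\<Sum>x\<in>?S. (f x)\<^sup>2) * real m"
    using assms(2) by (simp add: mult_left_mono sum_nonneg)
  finally show ?thesis by (simp add: eq mult.commute)
qed

text \<open>A nonzero increment has a support point at one of its ends, and every point is an end of
  at most two increments.\<close>

lemma card_increment_support:
  fixes f :: "int \<Rightarrow> real"
  shows "card {u \<in> {a..<b}. f (u + 1) - f u \<noteq> 0} \<le> 2 * card {t \<in> {a..b}. f t \<noteq> 0}"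
proof -
  let ?T = "{t \<in> {a..b}. f t \<noteq> 0}"
  have fin: "finite ?T" by (rule finite_subset[of _ "{a..b}"]) auto
  have "{u \<in> {a..<b}. f (u + 1) - f u \<noteq> 0} \<subseteq> ?T \<union> (\<lambda>t. t - 1) ` ?T"
  proof
    fix u assume u: "u \<in> {u \<in> {a..<b}. f (u + 1) - f u \<noteq> 0}"
    then have "f u \<noteq> 0 \<or> f (u + 1) \<noteq> 0" by auto
    then show "u \<in> ?T \<union> (\<lambda>t. t - 1) ` ?T" using u by (force intro: image_eqI[of _ _ "u + 1"])
  qed
  then have "card {u \<in> {a..<b}. f (u + 1) - f u \<noteq> 0} \<le> card (?T \<union> (\<lambda>t. t - 1) ` ?T)"
    using fin by (intro card_mono) auto
  also have "\<dots> \<le> card ?T + card ?T"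
    using card_Un_le[of ?T "(\<lambda>t. t - 1) ` ?T"] card_image_le[OF fin, of "\<lambda>t. t - 1"] by linarith
  finally show ?thesis by simp
qed

lemma line_sobolev:
  fixes f :: "int \<Rightarrow> real"
  assumes "t0 \<in> {a..b}" "t \<in> {a..b}" "f t0 = 0" and n: "card {t \<in> {a..b}. f t \<noteq> 0} \<le> n"
  shows "(f t)\<^sup>2 \<le> 2 * real n * (\<Sum>u\<in>{a..<b}. (f (u + 1) - f u)\<^sup>2)"
proof -
  have "(f t)\<^sup>2 \<le> (\<Sum>u\<in>{a..<b}. \<bar>f (u + 1) - f u\<bar>)\<^sup>2"
    using variation_bound[of t0 a b t f, OF assms(1-3)] by (metis abs_ge_zero power2_abs power_mono)
  also have "\<dots> \<le> real (2 * n) * (\<Sum>u\<in>{a..<b}. (f (u + 1) - f u)\<^sup>2)"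
    using card_increment_support[of a b f] n by (intro sum_abs_squared_le) auto
  finally show ?thesis by simp
qed

text \<open>Gagliardo--Nirenberg: a value is bounded by the variation along its row and by the
  variation along its column, and the product of the two decouples in the double sum.\<close>

lemma plane_sobolev:
  fixes f :: "int \<Rightarrow> int \<Rightarrow> real"
  assumes row: "\<And>s. s \<in> {a..b} \<Longrightarrow> \<exists>t\<in>{a..b}. f s t = 0"
    and col: "\<And>t. t \<in> {a..b} \<Longrightarrow> \<exists>s\<in>{a..b}. f s t = 0"
    and n: "card {(s, t). s \<in> {a..b} \<and> t \<in> {a..b} \<and> f s t \<noteq> 0} \<le> n"
  shows "(\<Sum>s\<in>{a..b}. \<Sum>t\<in>{a..b}. (f s t)\<^sup>2) \<le> real n *
    ((\<Sum>s\<in>{a..b}. \<Sum>t\<in>{a..<b}. (f s (t + 1) - f s t)\<^sup>2) +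
     (\<Sum>t\<in>{a..b}. \<Sum>s\<in>{a..<b}. (f (s + 1) t - f s t)\<^sup>2))"
proof -
  \<comment> \<open>All rows together have at most \<open>2 * n\<close> nonzero increments, so one
    application of Cauchy-Schwarz to the whole double sum has a constant linear in
    \<open>n\<close>.\<close>
  have key: "(\<Sum>s\<in>{a..b}. \<Sum>t\<in>{a..<b}. \<bar>g s (t + 1) - g s t\<bar>)\<^sup>2
      \<le> 2 * real n * (\<Sum>s\<in>{a..b}. \<Sum>t\<in>{a..<b}. (g s (t + 1) - g s t)\<^sup>2)"
    if g: "card {(s, t). s \<in> {a..b} \<and> t \<in> {a..b} \<and> g s t \<noteq> 0} \<le> n" for g :: "int \<Rightarrow> int \<Rightarrow> real"
  proof -
    let ?D = "\<lambda>(s, t). g s (t + 1) - g s t"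
    have fin: "finite {t \<in> T. P t}" if "finite T" for T :: "int set" and P
      by (rule finite_subset[OF _ that]) auto
    have "card {x \<in> {a..b} \<times> {a..<b}. ?D x \<noteq> 0}
        = card (SIGMA s:{a..b}. {t \<in> {a..<b}. g s (t + 1) - g s t \<noteq> 0})"
      by (rule arg_cong[where f = card]) auto
    also have "\<dots> = (\<Sum>s\<in>{a..b}. card {t \<in> {a..<b}. g s (t + 1) - g s t \<noteq> 0})"
      by (rule card_SigmaI) (auto intro!: fin simp del: atLeastLessThan_iff)
    also have "\<dots> \<le> (\<Sum>s\<in>{a..b}. 2 * card {t \<in> {a..b}. g s t \<noteq> 0})"
      by (intro sum_mono card_increment_support)
    also have "\<dots> = 2 * card (SIGMA s:{a..b}. {t \<in> {a..b}. g s t \<noteq> 0})"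
      by (subst card_SigmaI) (auto intro!: fin simp: sum_distrib_left simp del: atLeastAtMost_iff)
    also have "(SIGMA s:{a..b}. {t \<in> {a..b}. g s t \<noteq> 0})
        = {(s, t). s \<in> {a..b} \<and> t \<in> {a..b} \<and> g s t \<noteq> 0}" by auto
    finally have "card {x \<in> {a..b} \<times> {a..<b}. ?D x \<noteq> 0} \<le> 2 * n" using g by linarith
    from sum_abs_squared_le[OF _ this] show ?thesis
      by (simp add: sum.cartesian_product case_prod_unfold)
  qed
  define X where "X s = (\<Sum>t\<in>{a..<b}. \<bar>f s (t + 1) - f s t\<bar>)" for s
  define Y where "Y t = (\<Sum>s\<in>{a..<b}. \<bar>f (s + 1) t - f s t\<bar>)" for t
  have "(\<Sum>s\<in>{a..b}. \<Sum>t\<in>{a..b}. (f s t)\<^sup>2) \<le> (\<Sum>s\<in>{a..b}. \<Sum>t\<in>{a..b}. X s * Y t)"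
  proof (intro sum_mono)
    fix s t assume s: "s \<in> {a..b}" and t: "t \<in> {a..b}"
    have "\<bar>f s t\<bar> \<le> X s"
      using row[OF s] variation_bound[OF _ t, of _ "f s"] unfolding X_def by blast
    moreover have "\<bar>f s t\<bar> \<le> Y t"
      using col[OF t] variation_bound[OF _ s, of _ "\<lambda>s. f s t"] unfolding Y_def by blast
    ultimately have "\<bar>f s t\<bar> * \<bar>f s t\<bar> \<le> X s * Y t" by (intro mult_mono) auto
    then show "(f s t)\<^sup>2 \<le> X s * Y t" by (simp add: power2_eq_square flip: abs_mult)
  qed
  also have "\<dots> = (\<Sum>s\<in>{a..b}. X s) * (\<Sum>t\<in>{a..b}. Y t)" by (simp add: sum_product)
  also have "\<dots> \<le> ((\<Sum>s\<in>{a..b}. X s)\<^sup>2 + (\<Sum>t\<in>{a..b}. Y t)\<^sup>2) / 2"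
    using sum_squares_bound[of "\<Sum>s\<in>{a..b}. X s" "\<Sum>t\<in>{a..b}. Y t"] by simp
  also have "\<dots> \<le> (2 * real n * (\<Sum>s\<in>{a..b}. \<Sum>t\<in>{a..<b}. (f s (t + 1) - f s t)\<^sup>2) +
      2 * real n * (\<Sum>t\<in>{a..b}. \<Sum>s\<in>{a..<b}. (f (s + 1) t - f s t)\<^sup>2)) / 2"
  proof (intro divide_right_mono add_mono)
    \<comment> \<open>For the columns \<open>key\<close> is used with the arguments exchanged, which
      preserves the size of the support.\<close>
    have "card {(t, s). t \<in> {a..b} \<and> s \<in> {a..b} \<and> f s t \<noteq> 0}
        = card (prod.swap ` {(s, t). s \<in> {a..b} \<and> t \<in> {a..b} \<and> f s t \<noteq> 0})"
      by (rule arg_cong[where f = card]) auto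
    also have "\<dots> \<le> n" using n by (simp add: card_image)
    finally show "(\<Sum>t\<in>{a..b}. Y t)\<^sup>2
        \<le> 2 * real n * (\<Sum>t\<in>{a..b}. \<Sum>s\<in>{a..<b}. (f (s + 1) t - f s t)\<^sup>2)"
      using key[of "\<lambda>t s. f s t"] by (simp add: Y_def)
  qed (use key[OF n] in \<open>simp_all add: X_def\<close>)
  finally show ?thesis by (simp add: distrib_left)
qed

section \<open>Coordinate segments and faces of a shell\<close>

definition coord_upd :: "int ^ 'd \<Rightarrow> 'd \<Rightarrow> int \<Rightarrow> int ^ 'd" where
  "coord_upd z j t = (\<chi> i. if i = j then t else z $ i)"

lemma coord_upd_nth [simp]: "coord_upd z j t $ i = (if i = j then t else z $ i)"
  by (simp add: coord_upd_def)

lemma coord_upd_self [simp]: "coord_upd z j (z $ j) = z"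
  by (simp add: vec_eq_iff)

lemma coord_upd_idem [simp]: "coord_upd (coord_upd z j s) j t = coord_upd z j t"
  by (simp add: vec_eq_iff)

lemma coord_upd_commute: "i \<noteq> j \<Longrightarrow> coord_upd (coord_upd z i s) j t = coord_upd (coord_upd z j t) i s"
  by (simp add: vec_eq_iff)

lemma coord_upd_inj [simp]: "coord_upd z j s = coord_upd z j t \<longleftrightarrow> s = t"
  by (metis coord_upd_nth)

lemma adjacent_coord_upd [simp]: "adjacent (coord_upd z j t) (coord_upd z j (t + 1))"
proof -
  have "coord_upd z j (t + 1) - coord_upd z j t = axis j 1" by (simp add: vec_eq_iff axis_def)
  then show ?thesis by (simp add: adjacent_def)
qed

lemma adjacent_coord_succ [simp]: "adjacent z (coord_upd z j (z $ j + 1))"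
  using adjacent_coord_upd[of z j "z $ j"] by simp

text \<open>Coordinate \<open>i\<close> keeps the absolute value \<open>k\<close>, so the sup-norm
  cannot drop while another coordinate moves.\<close>

lemma sup_norm_coord_upd:
  assumes "\<bar>z $ i\<bar> = int k" "sup_norm z = k" "j \<noteq> i" "\<bar>t\<bar> \<le> int k"
  shows "sup_norm (coord_upd z j t) = k"
  using assms abs_le_sup_norm[of z] by (intro sup_norm_eqI[of _ _ i]) auto

definition shell :: "nat \<Rightarrow> (int ^ 'd) set" where
  "shell k = {z. sup_norm z = k}"

lemma finite_shell [simp]: "finite (shell k)"
  by (rule finite_subset[OF _ finite_sup_ball[of k]]) (auto simp: shell_def)

text \<open>Edges are ordered pairs, so each one is counted in both directions.\<close>

definition edge_set :: "(int ^ 'd) set \<Rightarrow> ((int ^ 'd) \<times> (int ^ 'd)) set" where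
  "edge_set B = {(z, z'). z \<in> B \<and> z' \<in> B \<and> adjacent z z'}"

lemma finite_edge_set [simp]: "finite B \<Longrightarrow> finite (edge_set B)"
  by (rule finite_subset[of _ "B \<times> B"]) (auto simp: edge_set_def)

text \<open>Only edges with both ends in \<open>B\<close> count. The edge sets of distinct shells
  are thus disjoint, and the shell energies add up to at most the energy of a box that contains the
  shells.\<close>

definition dirichlet_energy :: "(int ^ 'd) set \<Rightarrow> (int ^ 'd \<Rightarrow> real) \<Rightarrow> real" where
  "dirichlet_energy B v = (\<Sum>(z, z')\<in>edge_set B. (v z' - v z)\<^sup>2)"

lemma dirichlet_energy_nonneg: "0 \<le> dirichlet_energy B v"
  by (auto simp: dirichlet_energy_def intro: sum_nonneg)

lemma sum_le_dirichlet_energy: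
  assumes "finite B" "inj_on \<phi> A" "\<And>x. x \<in> A \<Longrightarrow> \<phi> x \<in> edge_set B"
  shows "(\<Sum>x\<in>A. (v (snd (\<phi> x)) - v (fst (\<phi> x)))\<^sup>2) \<le> dirichlet_energy B v"
proof -
  have "(\<Sum>x\<in>A. (v (snd (\<phi> x)) - v (fst (\<phi> x)))\<^sup>2) = (\<Sum>(z, z')\<in>\<phi> ` A. (v z' - v z)\<^sup>2)"
    by (subst sum.reindex[OF assms(2)]) (simp add: case_prod_unfold)
  also have "\<dots> \<le> dirichlet_energy B v"
    unfolding dirichlet_energy_def using assms by (intro sum_mono2) auto
  finally show ?thesis .
qed

lemma line_le_dirichlet_energy:
  assumes "finite B" "\<And>t. t \<in> {a..b} \<Longrightarrow> coord_upd z j t \<in> B"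
  shows "(\<Sum>u\<in>{a..<b}. (v (coord_upd z j (u + 1)) - v (coord_upd z j u))\<^sup>2) \<le> dirichlet_energy B v"
  using sum_le_dirichlet_energy[of B "\<lambda>u. (coord_upd z j u, coord_upd z j (u + 1))" "{a..<b}" v] assms
  by (auto simp: inj_on_def edge_set_def)

lemma card_coord_line_le:
  assumes fin: "finite \<Lambda>" and v: "\<And>z. z \<notin> \<Lambda> \<Longrightarrow> v z = (0 :: real)"
    and B: "\<And>t. t \<in> {a..b} \<Longrightarrow> coord_upd z j t \<in> B"
  shows "card {t \<in> {a..b}. v (coord_upd z j t) \<noteq> 0} \<le> card (\<Lambda> \<inter> B)"
proof -
  have "card {t \<in> {a..b}. v (coord_upd z j t) \<noteq> 0} = card (coord_upd z j ` {t \<in> {a..b}. v (coord_upd z j t) \<noteq> 0})"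
    by (simp add: card_image inj_on_def)
  also have "\<dots> \<le> card (\<Lambda> \<inter> B)" using fin v B by (intro card_mono) auto
  finally show ?thesis .
qed

text \<open>Pigeonhole: the segment has \<open>2 * k + 1\<close> sites, one more than
  \<open>\<Lambda>\<close> may have in \<open>B\<close>. The zero is the boundary condition of the
  Sobolev inequalities.\<close>

lemma coord_line_zero:
  assumes fin: "finite \<Lambda>" and v: "\<And>z. z \<notin> \<Lambda> \<Longrightarrow> v z = (0 :: real)"
    and B: "\<And>t. t \<in> {- int k..int k} \<Longrightarrow> coord_upd z j t \<in> B" and n: "card (\<Lambda> \<inter> B) \<le> 2 * k"
  shows "\<exists>t\<in>{- int k..int k}. v (coord_upd z j t) = 0"
proof (rule ccontr)
  assume "\<not> ?thesis"
  then have "{t \<in> {- int k..int k}. v (coord_upd z j t) \<noteq> 0} = {- int k..int k}" by auto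
  then show False
    using card_coord_line_le[of \<Lambda> v "- int k" "int k" z j B, OF fin v B] n by simp
qed

text \<open>Through each site of the shell runs a segment within the shell, along a coordinate other
  than one of maximal modulus. The line inequality costs one factor
  \<open>card (\<Lambda> \<inter> shell k)\<close>, the summation over the sites of
  \<open>\<Lambda>\<close> the other.\<close>

lemma shell_poincare_line:
  fixes v :: "int ^ 'd \<Rightarrow> real"
  assumes d: "CARD('d) \<ge> 2" and fin: "finite \<Lambda>" and v: "\<And>z. z \<notin> \<Lambda> \<Longrightarrow> v z = 0"
    and n: "card (\<Lambda> \<inter> shell k) \<le> 2 * k"
  shows "(\<Sum>z\<in>shell k. (v z)\<^sup>2) \<le> 2 * (real (card (\<Lambda> \<inter> shell k)))\<^sup>2 * dirichlet_energy (shell k) v"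
proof -
  let ?n = "card (\<Lambda> \<inter> shell k)" and ?E = "dirichlet_energy (shell k) v"
  have pt: "(v z)\<^sup>2 \<le> 2 * real ?n * ?E" if z: "z \<in> shell k" for z
  proof -
    obtain i where i: "\<bar>z $ i\<bar> = int k" using sup_norm_attained[of z] z by (auto simp: shell_def)
    have "\<not> UNIV \<subseteq> {i}" using d card_mono[of "{i}" UNIV] by auto
    then obtain j where j: "j \<noteq> i" by auto
    have line: "coord_upd z j t \<in> shell k" if "t \<in> {- int k..int k}" for t
      using that z i j by (auto simp: shell_def intro!: sup_norm_coord_upd)
    obtain t0 where t0: "t0 \<in> {- int k..int k}" "v (coord_upd z j t0) = 0"
      using coord_line_zero[of \<Lambda> v k z j "shell k", OF fin v line n] by blast
    have zj: "z $ j \<in> {- int k..int k}"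
      using z abs_le_sup_norm[of z j] by (auto simp: shell_def)
    have "(v (coord_upd z j (z $ j)))\<^sup>2
        \<le> 2 * real ?n * (\<Sum>u\<in>{- int k..<int k}. (v (coord_upd z j (u + 1)) - v (coord_upd z j u))\<^sup>2)"
      by (rule line_sobolev[OF t0(1) zj, of "\<lambda>t. v (coord_upd z j t)"])
         (use t0 card_coord_line_le[of \<Lambda> v "- int k" "int k" z j "shell k", OF fin v line] in auto)
    also have "\<dots> \<le> 2 * real ?n * ?E"
      by (intro mult_left_mono line_le_dirichlet_energy line) auto
    finally show ?thesis by simp
  qed
  have "(\<Sum>z\<in>shell k. (v z)\<^sup>2) = (\<Sum>z\<in>\<Lambda> \<inter> shell k. (v z)\<^sup>2)"
    using v by (intro sum.mono_neutral_right) auto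
  also have "\<dots> \<le> (\<Sum>z\<in>\<Lambda> \<inter> shell k. 2 * real ?n * ?E)" by (intro sum_mono pt) auto
  also have "\<dots> = 2 * (real ?n)\<^sup>2 * ?E" by (simp add: power2_eq_square)
  finally show ?thesis .
qed

text \<open>The map from \<open>(z, t)\<close> to \<open>(coord_upd z j t, z $ j)\<close> is an
  involution of \<open>F \<times> I\<close>. Averaging over the lines through all points replaces a
  partition of \<open>F\<close> into lines.\<close>

lemma coord_upd_average:
  fixes g :: "int ^ 'd \<Rightarrow> real"
  assumes "\<And>z. z \<in> F \<Longrightarrow> z $ j \<in> I" "\<And>z t. z \<in> F \<Longrightarrow> t \<in> I \<Longrightarrow> coord_upd z j t \<in> F"
  shows "(\<Sum>z\<in>F. \<Sum>t\<in>I. g (coord_upd z j t)) = real (card I) * (\<Sum>z\<in>F. g z)"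
proof -
  have "(\<Sum>z\<in>F. \<Sum>t\<in>I. g (coord_upd z j t)) = (\<Sum>(z, t)\<in>F \<times> I. g (coord_upd z j t))"
    by (rule sum.cartesian_product)
  also have "\<dots> = (\<Sum>(z, t)\<in>F \<times> I. g z)"
    by (rule sum.reindex_bij_witness[where i = "\<lambda>(z, t). (coord_upd z j t, z $ j)"
          and j = "\<lambda>(z, t). (coord_upd z j t, z $ j)"]) (auto simp: assms)
  also have "\<dots> = real (card I) * (\<Sum>z\<in>F. g z)"
    by (simp add: sum.cartesian_product[symmetric] sum_distrib_left)
  finally show ?thesis .
qed

text \<open>Overlaps are allowed because the faces of a cube share their edges.\<close>

lemma sum_Union_le:
  fixes g :: "'a \<Rightarrow> real"
  assumes "finite I" "\<And>i. i \<in> I \<Longrightarrow> finite (F i)" "S \<subseteq> (\<Union>i\<in>I. F i)" "\<And>x. 0 \<le> g x"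
  shows "sum g S \<le> (\<Sum>i\<in>I. sum g (F i))"
proof -
  have "sum g S \<le> sum g (snd ` Sigma I F)"
    using assms by (intro sum_mono2) (force simp: image_iff)+
  also have "\<dots> \<le> sum (g \<circ> snd) (Sigma I F)" using assms by (intro sum_image_le) auto
  also have "\<dots> = (\<Sum>i\<in>I. sum g (F i))" using assms by (simp add: sum.Sigma case_prod_unfold)
  finally show ?thesis .
qed

text \<open>Each point of the face lies on a square in the directions \<open>j\<close> and
  \<open>l\<close>, where \<open>plane_sobolev\<close> applies. Summing over the squares of all
  points multiplies both sides by the same squared side length, which cancels.\<close>

lemma face_poincare_plane:
  fixes v :: "int ^ 'd \<Rightarrow> real"
  assumes ijl: "j \<noteq> i" "l \<noteq> i" "j \<noteq> l" and fin: "finite \<Lambda>" and v: "\<And>z. z \<notin> \<Lambda> \<Longrightarrow> v z = 0"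
    and n: "card (\<Lambda> \<inter> shell k) \<le> 2 * k" and c: "\<bar>c\<bar> = int k"
  shows "(\<Sum>z | z \<in> shell k \<and> z $ i = c. (v z)\<^sup>2)
    \<le> 2 * real (card (\<Lambda> \<inter> shell k)) * dirichlet_energy (shell k) v"
proof -
  let ?n = "card (\<Lambda> \<inter> shell k)" and ?E = "dirichlet_energy (shell k) v"
    and ?F = "{z \<in> shell k. z $ i = c}" and ?I = "{- int k..int k}"
  \<comment> \<open>The value 0 at the end of a segment stands for the missing edge out of the face.
    With it the increments are summed over full squares, as \<open>avg\<close> requires.\<close>
  define g where "g q z = (if z $ q < int k then (v (coord_upd z q (z $ q + 1)) - v z)\<^sup>2 else 0)" for q z
  let ?u = "\<lambda>z s t. coord_upd (coord_upd z j s) l t"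
  have F1: "z $ q \<in> ?I" if "z \<in> ?F" for z q
    using that abs_le_sup_norm[of z q] by (auto simp: shell_def)
  have F2: "coord_upd z q t \<in> ?F" if "z \<in> ?F" "t \<in> ?I" "q \<noteq> i" for z q t
    using that c by (auto simp: shell_def intro!: sup_norm_coord_upd[of z i])
  have avg: "(\<Sum>z\<in>?F. \<Sum>s\<in>?I. \<Sum>t\<in>?I. f (?u z s t)) = (real (card ?I))\<^sup>2 * (\<Sum>z\<in>?F. f z)"
    for f :: "int ^ 'd \<Rightarrow> real"
  proof -
    have "(\<Sum>z\<in>?F. \<Sum>s\<in>?I. \<Sum>t\<in>?I. f (?u z s t)) = real (card ?I) * (\<Sum>z\<in>?F. \<Sum>t\<in>?I. f (coord_upd z l t))"
      by (rule coord_upd_average[of ?F j ?I "\<lambda>z. \<Sum>t\<in>?I. f (coord_upd z l t)"])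
         (use F1 F2 ijl in blast)+
    also have "(\<Sum>z\<in>?F. \<Sum>t\<in>?I. f (coord_upd z l t)) = real (card ?I) * (\<Sum>z\<in>?F. f z)"
      by (rule coord_upd_average) (use F1 F2 ijl in blast)+
    finally show ?thesis by (simp add: power2_eq_square)
  qed
  have half: "(\<Sum>t\<in>{- int k..<int k}. f t) = (\<Sum>t\<in>?I. if t < int k then f t else 0)"
    for f :: "int \<Rightarrow> real"
    by (intro sum.mono_neutral_cong_left) auto
  have plane: "(\<Sum>s\<in>?I. \<Sum>t\<in>?I. (v (?u z s t))\<^sup>2)
      \<le> real ?n * ((\<Sum>s\<in>?I. \<Sum>t\<in>?I. g l (?u z s t)) + (\<Sum>s\<in>?I. \<Sum>t\<in>?I. g j (?u z s t)))"
    if z: "z \<in> ?F" for z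
  proof -
    have mem: "?u z s t \<in> ?F" if "s \<in> ?I" "t \<in> ?I" for s t
      using F2 z that ijl by blast
    have "(\<Sum>s\<in>?I. \<Sum>t\<in>?I. (v (?u z s t))\<^sup>2) \<le> real ?n *
      ((\<Sum>s\<in>?I. \<Sum>t\<in>{- int k..<int k}. (v (?u z s (t + 1)) - v (?u z s t))\<^sup>2) +
       (\<Sum>t\<in>?I. \<Sum>s\<in>{- int k..<int k}. (v (?u z (s + 1) t) - v (?u z s t))\<^sup>2))"
    proof (rule plane_sobolev[of "- int k" "int k" "\<lambda>s t. v (?u z s t)"])
      show "\<exists>t\<in>?I. v (?u z s t) = 0" if "s \<in> ?I" for s
        by (rule coord_line_zero[of \<Lambda> v k _ l "shell k", OF fin v _ n]) (use mem that in auto)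
      show "\<exists>s\<in>?I. v (?u z s t) = 0" if "t \<in> ?I" for t
        unfolding coord_upd_commute[OF ijl(3)]
        by (rule coord_line_zero[of \<Lambda> v k _ j "shell k", OF fin v _ n])
           (use mem that in \<open>auto simp: coord_upd_commute[OF ijl(3)]\<close>)
      let ?P = "{(s, t). s \<in> ?I \<and> t \<in> ?I \<and> v (?u z s t) \<noteq> 0}"
      have "inj_on (\<lambda>(s, t). ?u z s t) ?P"
        using ijl(3) by (auto simp: inj_on_def vec_eq_iff)
      then have "card ?P = card ((\<lambda>(s, t). ?u z s t) ` ?P)" by (simp add: card_image)
      also have "\<dots> \<le> ?n" using fin v mem by (intro card_mono) auto
      finally show "card ?P \<le> ?n" .
    qed
    also have "(\<Sum>s\<in>?I. \<Sum>t\<in>{- int k..<int k}. (v (?u z s (t + 1)) - v (?u z s t))\<^sup>2)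
        = (\<Sum>s\<in>?I. \<Sum>t\<in>?I. g l (?u z s t))"
      unfolding half by (simp add: g_def cong: if_cong)
    also have "(\<Sum>t\<in>?I. \<Sum>s\<in>{- int k..<int k}. (v (?u z (s + 1) t) - v (?u z s t))\<^sup>2)
        = (\<Sum>t\<in>?I. \<Sum>s\<in>?I. g j (?u z s t))"
      unfolding half using ijl(3) by (simp add: g_def coord_upd_commute[OF ijl(3)] cong: if_cong)
    also have "\<dots> = (\<Sum>s\<in>?I. \<Sum>t\<in>?I. g j (?u z s t))" by (rule sum.swap)
    finally show ?thesis .
  qed
  \<comment> \<open>Distinct sites give distinct edges in direction \<open>q\<close>, and these stay
    in the face, hence in the shell.\<close>
  have g_le: "(\<Sum>z\<in>?F. g q z) \<le> ?E" if "q \<noteq> i" for q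
  proof -
    have edge: "(z, coord_upd z q (z $ q + 1)) \<in> edge_set (shell k)" if "z \<in> {z \<in> ?F. z $ q < int k}" for z
    proof -
      have "z \<in> ?F" "z $ q + 1 \<in> ?I" using that F1[of z q] by auto
      then have "coord_upd z q (z $ q + 1) \<in> ?F" using F2 \<open>q \<noteq> i\<close> by blast
      then show ?thesis using that by (simp add: edge_set_def)
    qed
    have "(\<Sum>z\<in>?F. g q z) = (\<Sum>z\<in>{z \<in> ?F. z $ q < int k}. (v (coord_upd z q (z $ q + 1)) - v z)\<^sup>2)"
      by (intro sum.mono_neutral_cong_right) (auto simp: g_def)
    also have "\<dots> \<le> ?E"
      using sum_le_dirichlet_energy[of "shell k" "\<lambda>z. (z, coord_upd z q (z $ q + 1))"
          "{z \<in> ?F. z $ q < int k}" v] edge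
      by (simp add: inj_on_def)
    finally show ?thesis .
  qed
  have "(real (card ?I))\<^sup>2 * (\<Sum>z\<in>?F. (v z)\<^sup>2) = (\<Sum>z\<in>?F. \<Sum>s\<in>?I. \<Sum>t\<in>?I. (v (?u z s t))\<^sup>2)"
    by (rule avg[of "\<lambda>z. (v z)\<^sup>2", symmetric])
  also have "\<dots> \<le> (\<Sum>z\<in>?F. real ?n *
      ((\<Sum>s\<in>?I. \<Sum>t\<in>?I. g l (?u z s t)) + (\<Sum>s\<in>?I. \<Sum>t\<in>?I. g j (?u z s t))))"
    by (intro sum_mono plane)
  also have "\<dots> = real ?n * ((\<Sum>z\<in>?F. \<Sum>s\<in>?I. \<Sum>t\<in>?I. g l (?u z s t)) +
      (\<Sum>z\<in>?F. \<Sum>s\<in>?I. \<Sum>t\<in>?I. g j (?u z s t)))"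
    by (simp only: sum.distrib sum_distrib_left distrib_left)
  also have "\<dots> = (real (card ?I))\<^sup>2 * (real ?n * ((\<Sum>z\<in>?F. g l z) + (\<Sum>z\<in>?F. g j z)))"
    unfolding avg by (simp add: algebra_simps)
  also have "\<dots> \<le> (real (card ?I))\<^sup>2 * (real ?n * (?E + ?E))"
    using g_le ijl by (intro mult_left_mono add_mono) auto
  finally show ?thesis by (simp add: mult_le_cancel_left mult.assoc)
qed

text \<open>The shell is covered by \<open>2 * CARD('d)\<close> faces. From dimension three on each
  face contains two coordinate directions, and the planar inequality makes the constant linear
  instead of quadratic in the number of cluster sites.\<close>

lemma shell_poincare_plane:
  fixes v :: "int ^ 'd \<Rightarrow> real"
  assumes d: "CARD('d) \<ge> 3" and fin: "finite \<Lambda>" and v: "\<And>z. z \<notin> \<Lambda> \<Longrightarrow> v z = 0"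
    and n: "card (\<Lambda> \<inter> shell k) \<le> 2 * k"
  shows "(\<Sum>z\<in>shell k. (v z)\<^sup>2)
    \<le> 4 * CARD('d) * real (card (\<Lambda> \<inter> shell k)) * dirichlet_energy (shell k) v"
proof -
  let ?n = "card (\<Lambda> \<inter> shell k)" and ?E = "dirichlet_energy (shell k) v"
  let ?F = "\<lambda>(i, c). {z \<in> shell k. z $ i = c} :: (int ^ 'd) set"
  have "(\<Sum>z\<in>shell k. (v z)\<^sup>2) \<le> (\<Sum>x\<in>UNIV \<times> {int k, - int k}. \<Sum>z\<in>?F x. (v z)\<^sup>2)"
  proof (rule sum_Union_le)
    show "shell k \<subseteq> (\<Union>x\<in>UNIV \<times> {int k, - int k}. ?F x)"
    proof
      fix z :: "int ^ 'd" assume z: "z \<in> shell k"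
      obtain i where "\<bar>z $ i\<bar> = int k" using sup_norm_attained[of z] z by (auto simp: shell_def)
      then have "z $ i = int k \<or> z $ i = - int k" by linarith
      then show "z \<in> (\<Union>x\<in>UNIV \<times> {int k, - int k}. ?F x)"
        using z by (intro UN_I[of "(i, z $ i)"]) auto
    qed
  qed auto
  also have "\<dots> \<le> (\<Sum>x\<in>(UNIV :: 'd set) \<times> {int k, - int k}. 2 * real ?n * ?E)"
  proof (intro sum_mono)
    fix x assume x: "x \<in> (UNIV :: 'd set) \<times> {int k, - int k}"
    obtain i c where ic: "x = (i, c)" "\<bar>c\<bar> = int k" using x by auto
    have "\<not> UNIV \<subseteq> {i}" using d card_mono[of "{i}" UNIV] by auto
    then obtain j where j: "j \<noteq> i" by auto
    have "\<not> UNIV \<subseteq> {i, j}" using d card_mono[of "{i, j}" UNIV] card_insert_le_m1[of 2 "{j}" i] by auto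
    then obtain l where "l \<noteq> i" "l \<noteq> j" by auto
    then show "(\<Sum>z\<in>?F x. (v z)\<^sup>2) \<le> 2 * real ?n * ?E"
      using face_poincare_plane[of j i l \<Lambda> v k c, OF j _ _ fin v n ic(2)] by (simp add: ic)
  qed
  also have "\<dots> \<le> 4 * CARD('d) * real ?n * ?E"
  proof -
    have "card ((UNIV :: 'd set) \<times> {int k, - int k}) \<le> CARD('d) * 2"
      unfolding card_cartesian_product using card_insert_le_m1[of 2 "{- int k}" "int k"] by (intro mult_left_mono) auto
    then have "real (card ((UNIV :: 'd set) \<times> {int k, - int k})) * (2 * real ?n * ?E)
        \<le> real (CARD('d) * 2) * (2 * real ?n * ?E)"
      by (intro mult_right_mono) (simp_all only: of_nat_le_iff, simp add: dirichlet_energy_nonneg)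
    then show ?thesis by simp
  qed
  finally show ?thesis .
qed

section \<open>The Agmon estimate\<close>

lemma exp_le_quadratic:
  fixes t :: real
  assumes "\<bar>t\<bar> \<le> 1" shows "exp t \<le> 1 + t + t\<^sup>2"
proof (cases "t \<ge> 0")
  case True
  then show ?thesis using exp_bound[of t] assms by simp
next
  case False
  have "(1 - t) * exp t \<le> exp (- t) * exp t"
    using exp_ge_add_one_self[of "- t"] by (intro mult_right_mono) auto
  also have "\<dots> = 1" by (simp flip: exp_add)
  \<comment> \<open>The product equals \<open>1 - t^3\<close>, which is at least 1 for negative
    \<open>t\<close>.\<close>
  also have "1 \<le> (1 - t) * (1 + t + t\<^sup>2)"
    using False mult_nonneg_nonneg[of "t\<^sup>2" "- t"] by (simp add: algebra_simps power2_eq_square)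
  finally show ?thesis using False by (simp add: mult_le_cancel_left)
qed

lemma exp_plus_exp_minus_le:
  fixes t :: real
  assumes "\<bar>t\<bar> \<le> 1" shows "exp t + exp (- t) - 2 \<le> 2 * t\<^sup>2"
  using exp_le_quadratic[of t] exp_le_quadratic[of "- t"] assms by simp

text \<open>The ground state substitution for a single edge.\<close>

lemma weighted_edge_bound:
  fixes h h' s s' :: real
  assumes "h \<ge> 0" "h' \<ge> 0" "\<bar>s - s'\<bar> \<le> 1"
  defines "v \<equiv> exp (- s) * h" and "v' \<equiv> exp (- s') * h'"
  shows "(v' - v)\<^sup>2 - (s - s')\<^sup>2 * (v\<^sup>2 + v'\<^sup>2) \<le> (h - h') * (exp (- 2 * s) * h - exp (- 2 * s') * h')"
proof -
  have cross: "exp (- 2 * s) * (h * h') = v * v' * exp (s' - s)"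
    "exp (- 2 * s') * (h * h') = v * v' * exp (- (s' - s))"
    unfolding v_def v'_def by (simp_all add: algebra_simps flip: exp_add)
  have sq: "v\<^sup>2 = exp (- 2 * s) * h * h" "v'\<^sup>2 = exp (- 2 * s') * h' * h'"
    unfolding v_def v'_def by (simp_all add: power2_eq_square algebra_simps flip: exp_add)
  have "(h - h') * (exp (- 2 * s) * h - exp (- 2 * s') * h')
      = v\<^sup>2 + v'\<^sup>2 - exp (- 2 * s) * (h * h') - exp (- 2 * s') * (h * h')"
    unfolding sq by (simp add: algebra_simps)
  \<comment> \<open>The last bracket is \<open>2 * cosh (s' - s) - 2\<close>, the error caused by
    the weight.\<close>
  also have "\<dots> = (v' - v)\<^sup>2 - v * v' * (exp (s' - s) + exp (- (s' - s)) - 2)"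
    unfolding cross by (simp add: algebra_simps power2_eq_square)
  finally have eq: "(h - h') * (exp (- 2 * s) * h - exp (- 2 * s') * h')
      = (v' - v)\<^sup>2 - v * v' * (exp (s' - s) + exp (- (s' - s)) - 2)" .
  have vv: "0 \<le> v * v'" using assms(1,2) by (simp add: v_def v'_def)
  have "v * v' * (exp (s' - s) + exp (- (s' - s)) - 2) \<le> v * v' * (2 * (s' - s)\<^sup>2)"
    using vv assms(3) by (intro mult_left_mono exp_plus_exp_minus_le) auto
  also have "\<dots> = (s - s')\<^sup>2 * (2 * v * v')" by (simp add: power2_commute)
  also have "\<dots> \<le> (s - s')\<^sup>2 * (v\<^sup>2 + v'\<^sup>2)"
    by (intro mult_left_mono sum_squares_bound) auto
  finally show ?thesis using eq by simp
qed

lemma sum_edge_set: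
  assumes "finite B"
  shows "(\<Sum>(z, z')\<in>edge_set B. f z z') = (\<Sum>z\<in>B. \<Sum>z' | z' \<in> B \<and> adjacent z z'. f z z')"
proof -
  have "edge_set B = (SIGMA z:B. {z'. z' \<in> B \<and> adjacent z z'})" by (auto simp: edge_set_def)
  then show ?thesis using assms by (simp add: sum.Sigma)
qed

lemma sum_edge_set_swap: "(\<Sum>(z, z')\<in>edge_set B. f z z') = (\<Sum>(z, z')\<in>edge_set B. f z' z)"
  by (rule sum.reindex_bij_witness[where i = prod.swap and j = prod.swap])
     (auto simp: edge_set_def adjacent_sym)

text \<open>An Agmon estimate: \<open>\<gamma> k\<close> is the rate of decay that the Poincare inequality on shell
  \<open>k\<close> can pay for. Half of the Dirichlet energy of \<open>exp (- s) h\<close> absorbs the error made by the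
  weight, and the other half is controlled by the single point \<open>y\<close> where \<open>h\<close> is not harmonic.\<close>

lemma agmon_estimate:
  fixes h :: "int ^ 'd \<Rightarrow> real" and s \<gamma> :: "nat \<Rightarrow> real"
  assumes fin: "finite \<Lambda>" and y: "y \<in> \<Lambda>" and x: "x \<in> \<Lambda>"
    and h0: "\<And>z. 0 \<le> h z" and out: "\<And>z. z \<notin> \<Lambda> \<Longrightarrow> h z = 0" and hy: "h y = 1"
    and harm: "\<And>z. z \<in> \<Lambda> \<Longrightarrow> z \<noteq> y \<Longrightarrow> (\<Sum>e\<in>unit_steps. h (z + e)) = 2 * CARD('d) * h z"
    and \<gamma>: "\<And>k. 0 \<le> \<gamma> k" "\<And>k. \<gamma> k \<le> 1"
    and slope: "\<And>k. \<bar>s (Suc k) - s k\<bar> \<le> \<gamma> k" "\<And>k. \<bar>s (Suc k) - s k\<bar> \<le> \<gamma> (Suc k)"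
    and poincare: "\<And>k v. (\<And>z. z \<notin> \<Lambda> \<Longrightarrow> v z = 0) \<Longrightarrow>
       8 * CARD('d) * (\<gamma> k)\<^sup>2 * (\<Sum>z\<in>shell k. (v z)\<^sup>2) \<le> dirichlet_energy (shell k) v"
  shows "(h x)\<^sup>2 \<le> 16 * CARD('d) * card \<Lambda> * exp (2 * s (sup_norm x) - 2 * s (sup_norm y))"
proof -
  \<comment> \<open>The successor puts all neighbours of \<open>\<Lambda>\<close> into the box
    \<open>B\<close> and keeps the outermost shell of \<open>B\<close> free of
    \<open>\<Lambda>\<close>.\<close>
  define R where "R = Suc (Max (sup_norm ` \<Lambda>))"
  define B where "B = {z :: int ^ 'd. sup_norm z \<le> R}"
  define w where "w z = exp (- s (sup_norm z))" for z :: "int ^ 'd"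
  define w2 where "w2 z = exp (- 2 * s (sup_norm z))" for z :: "int ^ 'd"
  define v where "v z = w z * h z" for z
  have finB: "finite B" by (simp add: B_def)
  have less_R: "sup_norm z < R" if "z \<in> \<Lambda>" for z
    using fin that by (auto simp: R_def less_Suc_eq_le)
  have \<Lambda>B: "\<Lambda> \<subseteq> B" using less_R by (auto simp: B_def less_imp_le)
  have nbr: "{z'. z' \<in> B \<and> adjacent z z'} = {z'. adjacent z z'}" if "z \<in> \<Lambda>" for z
    using less_R[OF that] adjacent_sup_norm[of z] by (fastforce simp: B_def)
  have v_out: "v z = 0" if "z \<notin> \<Lambda>" for z using out that by (simp add: v_def)
  \<comment> \<open>\<open>?Q\<close> is the Dirichlet form of \<open>h\<close> against
    \<open>w2 * h\<close>. Exchanging the ends of the edges turns it into twice the sum of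
    \<open>w2 * h\<close> times the graph Laplacian of \<open>h\<close>, where only \<open>y\<close>
    contributes.\<close>
  let ?Q = "\<Sum>(z, z')\<in>edge_set B. (h z - h z') * (w2 z * h z - w2 z' * h z')"
  have "?Q = (\<Sum>(z, z')\<in>edge_set B. (h z - h z') * (w2 z * h z)) -
      (\<Sum>(z, z')\<in>edge_set B. (h z - h z') * (w2 z' * h z'))"
    by (simp add: right_diff_distrib sum_subtractf case_prod_unfold)
  also have "(\<Sum>(z, z')\<in>edge_set B. (h z - h z') * (w2 z' * h z'))
      = - (\<Sum>(z, z')\<in>edge_set B. (h z - h z') * (w2 z * h z))"
    by (subst sum_edge_set_swap) (simp add: case_prod_unfold algebra_simps flip: sum_negf)
  also have "(\<Sum>(z, z')\<in>edge_set B. (h z - h z') * (w2 z * h z))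
      = (\<Sum>z\<in>B. w2 z * h z * (\<Sum>z' | z' \<in> B \<and> adjacent z z'. h z - h z'))"
    by (simp add: sum_edge_set[OF finB] sum_distrib_left mult.commute mult.left_commute)
  also have "\<dots> \<le> (\<Sum>z\<in>B. if z = y then w2 y * (2 * CARD('d)) else 0)"
  proof (rule sum_mono)
    fix z assume "z \<in> B"
    have lap: "(\<Sum>z' | z' \<in> B \<and> adjacent z z'. h z - h z') = 2 * CARD('d) * h z - (\<Sum>e\<in>unit_steps. h (z + e))"
      if "z \<in> \<Lambda>"
      unfolding nbr[OF that] by (simp add: sum_subtractf sum_adjacent card_adjacent)
    show "w2 z * h z * (\<Sum>z' | z' \<in> B \<and> adjacent z z'. h z - h z') \<le> (if z = y then w2 y * (2 * CARD('d)) else 0)"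
    proof (cases "z = y")
      case True
      have "0 \<le> (\<Sum>e\<in>unit_steps. h (y + e))" using h0 by (intro sum_nonneg) auto
      then have "(\<Sum>z' | z' \<in> B \<and> adjacent z z'. h z - h z') \<le> 2 * CARD('d)"
        using lap y hy True by simp
      then have "w2 y * (\<Sum>z' | z' \<in> B \<and> adjacent z z'. h z - h z') \<le> w2 y * (2 * CARD('d))"
        by (intro mult_left_mono) (auto simp: w2_def)
      then show ?thesis using True hy by simp
    next
      case False
      then show ?thesis using lap harm[of z] out[of z] by (cases "z \<in> \<Lambda>") auto
    qed
  qed
  also have "\<dots> = w2 y * (2 * CARD('d))" using finB y \<Lambda>B by auto
  finally have Q_le: "?Q \<le> 4 * CARD('d) * w2 y" by (simp add: mult_ac)
  let ?g = "\<lambda>z. (\<gamma> (sup_norm z))\<^sup>2 * (v z)\<^sup>2"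
  \<comment> \<open>The slope between the two shells is at most the rate on either of them, so the
    error of an edge is split between its two ends.\<close>
  have edge: "(v z' - v z)\<^sup>2 - (?g z + ?g z') \<le> (h z - h z') * (w2 z * h z - w2 z' * h z')"
    if "(z, z') \<in> edge_set B" for z z'
  proof -
    let ?d = "\<bar>s (sup_norm z) - s (sup_norm z')\<bar>"
    have adj: "adjacent z z'" using that by (simp add: edge_set_def)
    have "sup_norm z' = sup_norm z \<or> sup_norm z' = Suc (sup_norm z) \<or> sup_norm z = Suc (sup_norm z')"
      using adjacent_sup_norm[OF adj] adjacent_sup_norm[of z' z] adj adjacent_sym[of z z'] by linarith
    then have d: "?d \<le> \<gamma> (sup_norm z)" "?d \<le> \<gamma> (sup_norm z')"
      using slope[of "sup_norm z"] slope[of "sup_norm z'"] \<gamma>(1) by (auto simp: abs_minus_commute)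
    have d1: "?d \<le> 1" using d(1) \<gamma>(2)[of "sup_norm z"] by linarith
    have "?d\<^sup>2 * ((v z)\<^sup>2 + (v z')\<^sup>2) = ?d\<^sup>2 * (v z)\<^sup>2 + ?d\<^sup>2 * (v z')\<^sup>2" by (simp add: distrib_left)
    also have "\<dots> \<le> ?g z + ?g z'"
      using d by (intro add_mono mult_right_mono power_mono) auto
    finally show ?thesis
      using weighted_edge_bound[OF h0[of z] h0[of z'] d1] by (simp add: v_def w_def w2_def)
  qed
  have "(\<Sum>(z, z')\<in>edge_set B. (v z' - v z)\<^sup>2 - (?g z + ?g z')) \<le> ?Q"
    using edge by (intro sum_mono) auto
  then have "dirichlet_energy B v - (\<Sum>(z, z')\<in>edge_set B. ?g z) - (\<Sum>(z, z')\<in>edge_set B. ?g z') \<le> ?Q"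
    by (simp add: dirichlet_energy_def case_prod_unfold sum_subtractf sum.distrib)
  moreover have "(\<Sum>(z, z')\<in>edge_set B. ?g z') = (\<Sum>(z, z')\<in>edge_set B. ?g z)"
    by (rule sum_edge_set_swap)
  \<comment> \<open>Each site has at most \<open>2 * CARD('d)\<close> neighbours. After grouping by
    shells, the constant 8 in \<open>poincare\<close> thus leaves the factor 4.\<close>
  moreover have "4 * (\<Sum>(z, z')\<in>edge_set B. ?g z) \<le> dirichlet_energy B v"
  proof -
    have "(\<Sum>(z, z')\<in>edge_set B. ?g z) = (\<Sum>z\<in>B. card {z'. z' \<in> B \<and> adjacent z z'} * ?g z)"
      by (simp add: sum_edge_set[OF finB])
    also have "\<dots> \<le> (\<Sum>z\<in>B. 2 * CARD('d) * ?g z)"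
    proof (intro sum_mono mult_right_mono)
      fix z :: "int ^ 'd"
      have "card {z'. z' \<in> B \<and> adjacent z z'} \<le> card {z'. adjacent z z'}" by (intro card_mono) auto
      then show "real (card {z'. z' \<in> B \<and> adjacent z z'}) \<le> real (2 * CARD('d))"
        unfolding card_adjacent by (simp only: of_nat_le_iff)
    qed auto
    also have "\<dots> = (\<Sum>k\<le>R. \<Sum>z | z \<in> B \<and> sup_norm z = k. 2 * CARD('d) * ?g z)"
      by (rule sum.group[symmetric]) (auto simp: finB, auto simp: B_def)
    also have "\<dots> = (\<Sum>k\<le>R. 2 * CARD('d) * (\<gamma> k)\<^sup>2 * (\<Sum>z\<in>shell k. (v z)\<^sup>2))"
      by (intro sum.cong) (auto simp: sum_distrib_left B_def shell_def intro!: sum.cong)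
    also have "4 * \<dots> = (\<Sum>k\<le>R. 8 * CARD('d) * (\<gamma> k)\<^sup>2 * (\<Sum>z\<in>shell k. (v z)\<^sup>2))"
      unfolding sum_distrib_left[of 4] by (intro sum.cong) auto
    also have "\<dots> \<le> (\<Sum>k\<le>R. dirichlet_energy (shell k) v)"
      using v_out by (intro sum_mono poincare) auto
    also have "\<dots> = (\<Sum>x\<in>(\<Union>k\<le>R. edge_set (shell k)). (v (snd x) - v (fst x))\<^sup>2)"
      unfolding dirichlet_energy_def case_prod_unfold
      by (rule sum.UNION_disjoint[symmetric], simp, simp, auto simp: edge_set_def shell_def)
    also have "\<dots> \<le> dirichlet_energy B v"
      unfolding dirichlet_energy_def case_prod_unfold using finB
      by (intro sum_mono2 finite_edge_set) (auto simp: edge_set_def shell_def B_def)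
    finally show ?thesis by simp
  qed
  \<comment> \<open>The two error sums together take at most half of the energy, so the energy is at
    most \<open>2 * ?Q\<close>.\<close>
  ultimately have E_le: "dirichlet_energy B v \<le> 8 * CARD('d) * w2 y" using Q_le by linarith
  \<comment> \<open>Any direction serves. The segment from \<open>x\<close> to the outermost shell
    of \<open>B\<close> ends where \<open>v\<close> vanishes, so the energy bounds
    \<open>v x\<close>.\<close>
  obtain j :: 'd where True by simp
  have abs_xj: "\<bar>x $ j\<bar> < int R" using abs_le_sup_norm[of x j] less_R[OF x] by linarith
  have line: "coord_upd x j t \<in> B" if "t \<in> {x $ j..int R}" for t
  proof -
    have "\<bar>coord_upd x j t $ i\<bar> \<le> int R" for i
      using that abs_xj abs_le_sup_norm[of x i] less_R[OF x] by (cases "i = j") auto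
    then show ?thesis by (simp add: B_def sup_norm_le_iff)
  qed
  have "coord_upd x j (int R) \<notin> \<Lambda>"
    using less_R[of "coord_upd x j (int R)"] abs_le_sup_norm[of "coord_upd x j (int R)" j] by auto
  then have end0: "v (coord_upd x j (int R)) = 0" by (rule v_out)
  have n_le: "card {t \<in> {x $ j..int R}. v (coord_upd x j t) \<noteq> 0} \<le> card \<Lambda>"
    using card_coord_line_le[of \<Lambda> v "x $ j" "int R" x j UNIV, OF fin v_out] by simp
  have "(v (coord_upd x j (x $ j)))\<^sup>2 \<le> 2 * real (card \<Lambda>) *
      (\<Sum>u\<in>{x $ j..<int R}. (v (coord_upd x j (u + 1)) - v (coord_upd x j u))\<^sup>2)"
    by (rule line_sobolev[of "int R" "x $ j" "int R" "x $ j" "\<lambda>t. v (coord_upd x j t)"])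
       (use abs_xj end0 n_le in auto)
  also have "\<dots> \<le> 2 * real (card \<Lambda>) * (8 * CARD('d) * w2 y)"
    using line_le_dirichlet_energy[OF finB line] E_le by (intro mult_left_mono) (auto intro: order_trans)
  finally have vx: "(v x)\<^sup>2 \<le> 16 * CARD('d) * card \<Lambda> * w2 y" by (simp add: mult_ac)
  have "(h x)\<^sup>2 = (v x)\<^sup>2 * exp (2 * s (sup_norm x))"
    by (simp add: v_def w_def power_mult_distrib flip: exp_add exp_of_nat_mult)
  also have "\<dots> \<le> 16 * CARD('d) * card \<Lambda> * w2 y * exp (2 * s (sup_norm x))"
    using vx by (intro mult_right_mono) auto
  finally show ?thesis by (simp add: w2_def mult.assoc exp_diff exp_minus field_simps)
qed

section \<open>Walks confined to a set\<close>

text \<open>The event involves a single walk and a fixed set, so for prescribed sets and targets the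
  events of different walks are independent.\<close>

definition visit_within :: "(int ^ 'd) set \<Rightarrow> int ^ 'd \<Rightarrow> int ^ 'd \<Rightarrow> (nat \<Rightarrow> int ^ 'd) set" where
  "visit_within \<Lambda> y x = {s. \<exists>t. trajectory x s t = y \<and> (\<forall>i\<le>t. trajectory x s i \<in> \<Lambda>)}"

lemma space_step_sequences [simp]: "space step_sequences = UNIV"
  by (simp add: step_sequences_def space_PiM)

lemma sets_step_sequences: "sets step_sequences = sets (\<Pi>\<^sub>M n\<in>UNIV. count_space UNIV)"
  unfolding step_sequences_def by (intro sets_PiM_cong) auto

lemma prob_space_step_sequences: "prob_space step_sequences"
  unfolding step_sequences_def by (intro prob_space_PiM measure_pmf.prob_space_axioms)

lemma measurable_trajectory_single:
  "(\<lambda>s. trajectory x s t) \<in> step_sequences \<rightarrow>\<^sub>M count_space (UNIV :: (int ^ 'd) set)"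
proof (induction t)
  case 0
  then show ?case by (simp add: trajectory_def)
next
  case (Suc t)
  have step: "(\<lambda>s. s t) \<in> step_sequences \<rightarrow>\<^sub>M count_space (UNIV :: (int ^ 'd) set)"
    unfolding measurable_cong_sets[OF sets_step_sequences refl] by simp
  have "(\<lambda>s. trajectory x s t + s t) \<in> step_sequences \<rightarrow>\<^sub>M count_space (UNIV :: (int ^ 'd) set)"
  proof (rule measurable_compose_countable'[OF _ Suc.IH countableI_type])
    show "(\<lambda>s. y + s t) \<in> step_sequences \<rightarrow>\<^sub>M count_space UNIV" for y :: "int ^ 'd"
      using measurable_compose[OF step, of "\<lambda>z. y + z" "count_space UNIV"] by simp
  qed
  then show ?case by (simp add: trajectory_def add.assoc)
qed

lemma sets_visit_within: "visit_within \<Lambda> y x \<in> sets step_sequences"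
proof -
  have *: "Measurable.pred step_sequences (\<lambda>s. trajectory x s t \<in> X)" for t X
    using measurable_compose[OF measurable_trajectory_single, of "\<lambda>z. z \<in> X" "count_space UNIV"]
    by simp
  note [measurable] = *[of _ "{y}", simplified] *[of _ \<Lambda>]
  have "Measurable.pred step_sequences
     (\<lambda>s. \<exists>t. trajectory x s t = y \<and> (\<forall>i\<in>{..t}. trajectory x s i \<in> \<Lambda>))"
    by measurable
  then show ?thesis by (simp add: visit_within_def pred_def Ball_def)
qed

lemma trajectory_0 [simp]: "trajectory x s 0 = x"
  by (simp add: trajectory_def)

lemma trajectory_Suc: "trajectory x s (Suc t) = trajectory x s t + s t"
  by (simp add: trajectory_def)

lemma trajectory_case_nat: "trajectory x (case_nat e s) (Suc t) = trajectory (x + e) s t"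
  unfolding trajectory_def sum.lessThan_Suc_shift by (simp add: add.assoc)

lemma all_le_Suc_split: "(\<forall>i\<le>Suc t. P i) \<longleftrightarrow> P 0 \<and> (\<forall>i\<le>t. P (Suc i))"
  using less_Suc_eq_0_disj[of _ "Suc t"] by (auto simp: less_Suc_eq_le)

lemma ex_nat_split: "(\<exists>t. P t) \<longleftrightarrow> P 0 \<or> (\<exists>t. P (Suc t))"
  by (metis not0_implies_Suc)

lemma case_nat_visit_within:
  assumes "x \<in> \<Lambda>" "x \<noteq> y"
  shows "case_nat e s \<in> visit_within \<Lambda> y x \<longleftrightarrow> s \<in> visit_within \<Lambda> y (x + e)"
  unfolding visit_within_def mem_Collect_eq
  by (subst ex_nat_split) (simp add: assms all_le_Suc_split trajectory_case_nat)

definition visit_prob :: "(int ^ 'd) set \<Rightarrow> int ^ 'd \<Rightarrow> int ^ 'd \<Rightarrow> real" where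
  "visit_prob \<Lambda> y x = measure step_sequences (visit_within \<Lambda> y x)"

lemma visit_prob_outside: "x \<notin> \<Lambda> \<Longrightarrow> visit_prob \<Lambda> y x = 0"
proof -
  assume "x \<notin> \<Lambda>"
  then have "visit_within \<Lambda> y x = {}" by (auto simp: visit_within_def intro!: exI[of _ 0])
  then show ?thesis by (simp add: visit_prob_def)
qed

lemma visit_prob_self: "y \<in> \<Lambda> \<Longrightarrow> visit_prob \<Lambda> y y = 1"
proof -
  assume "y \<in> \<Lambda>"
  then have "visit_within \<Lambda> y y = UNIV" by (auto simp: visit_within_def intro!: exI[of _ 0])
  then show ?thesis
    using prob_space.prob_space[OF prob_space_step_sequences] by (simp add: visit_prob_def)
qed

text \<open>First-step analysis. The assumptions ensure that the walk has neither left
  \<open>\<Lambda>\<close> nor arrived before its first step.\<close>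

lemma visit_prob_harmonic:
  fixes x :: "int ^ 'd"
  assumes "x \<in> \<Lambda>" "x \<noteq> y"
  shows "(\<Sum>e\<in>unit_steps. visit_prob \<Lambda> y (x + e)) = 2 * CARD('d) * visit_prob \<Lambda> y x"
proof -
  let ?p = "pmf_of_set (unit_steps :: (int ^ 'd) set)"
  interpret sequence_space "measure_pmf ?p" by unfold_locales
  let ?S = "\<Pi>\<^sub>M n\<in>(UNIV::nat set). measure_pmf ?p"
  have S: "?S = step_sequences" by (simp add: step_sequences_def)
  let ?E = "visit_within \<Lambda> y x"
  have m: "(\<lambda>(e, s). case_nat e s) \<in> measure_pmf ?p \<Otimes>\<^sub>M ?S \<rightarrow>\<^sub>M ?S"
    by measurable
  have E: "?E \<in> sets ?S" using sets_visit_within S by metis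
  \<comment> \<open>Prepending an independent uniform step preserves the law of a step
    sequence.\<close>
  have "emeasure ?S ?E = emeasure (distr (measure_pmf ?p \<Otimes>\<^sub>M ?S) ?S (\<lambda>(e, s). case_nat e s)) ?E"
    by (simp only: PiM_iter)
  also have "\<dots> = emeasure (measure_pmf ?p \<Otimes>\<^sub>M ?S)
      ((\<lambda>(e, s). case_nat e s) -` ?E \<inter> space (measure_pmf ?p \<Otimes>\<^sub>M ?S))"
    by (rule emeasure_distr[OF m E])
  also have "\<dots> = (\<integral>\<^sup>+ e. emeasure ?S (Pair e -`
      ((\<lambda>(e, s). case_nat e s) -` ?E \<inter> space (measure_pmf ?p \<Otimes>\<^sub>M ?S))) \<partial>measure_pmf ?p)"
    by (rule P.emeasure_pair_measure_alt[OF measurable_sets[OF m E]])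
  also have "\<dots> = (\<integral>\<^sup>+ e. emeasure ?S (visit_within \<Lambda> y (x + e)) \<partial>measure_pmf ?p)"
    by (intro nn_integral_cong arg_cong[where f = "emeasure ?S"])
       (auto simp: space_pair_measure space_PiM case_nat_visit_within[OF assms])
  also have "\<dots> = (\<integral>\<^sup>+ e. ennreal (visit_prob \<Lambda> y (x + e)) \<partial>measure_pmf ?p)"
    by (simp add: S visit_prob_def finite_measure.emeasure_eq_measure
      prob_space.finite_measure prob_space_step_sequences)
  also have "\<dots> = ennreal ((\<Sum>e\<in>unit_steps. visit_prob \<Lambda> y (x + e)) / (2 * CARD('d)))"
  proof -
    have "of_nat (card (unit_steps :: (int ^ 'd) set)) = ennreal (2 * real CARD('d))"
      by (simp add: card_unit_steps ennreal_of_nat_eq_real_of_nat ennreal_mult')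
    then show ?thesis
      by (subst nn_integral_pmf_of_set)
         (simp_all add: sum_ennreal visit_prob_def divide_ennreal sum_nonneg del: ennreal_mult' ennreal_mult'')
  qed
  finally have "ennreal (visit_prob \<Lambda> y x) =
      ennreal ((\<Sum>e\<in>unit_steps. visit_prob \<Lambda> y (x + e)) / (2 * CARD('d)))"
    by (simp add: S visit_prob_def finite_measure.emeasure_eq_measure
      prob_space.finite_measure prob_space_step_sequences)
  then have "visit_prob \<Lambda> y x = (\<Sum>e\<in>unit_steps. visit_prob \<Lambda> y (x + e)) / (2 * CARD('d))"
    by (subst (asm) ennreal_inj) (auto simp: visit_prob_def intro!: divide_nonneg_nonneg sum_nonneg)
  then show ?thesis by simp
qed

section \<open>Almost sure unit steps and independence of the walks\<close>

lemma AE_walks_unit_steps: "AE \<omega> in walks. \<forall>j n. \<omega> j n \<in> (unit_steps :: (int ^ 'd) set)"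
  unfolding AE_all_countable
proof (intro allI)
  fix j n
  have "AE e in measure_pmf (pmf_of_set unit_steps). e \<in> (unit_steps :: (int ^ 'd) set)"
    by (simp add: AE_measure_pmf_iff set_pmf_of_set)
  then have "AE s in step_sequences. s n \<in> (unit_steps :: (int ^ 'd) set)"
    unfolding step_sequences_def
    by (rule AE_PiM_component[rotated 2]) (auto intro: measure_pmf.prob_space_axioms)
  then show "AE \<omega> in walks. \<omega> j n \<in> (unit_steps :: (int ^ 'd) set)"
    unfolding walks_def
    by (rule AE_PiM_component[rotated 2]) (auto intro: prob_space_step_sequences)
qed

lemma walks_prob_Collect:
  assumes "finite J" and "\<And>j. j \<in> J \<Longrightarrow> E j \<in> sets step_sequences"
  shows "measure walks {\<omega> \<in> space walks. \<forall>j\<in>J. \<omega> j \<in> E j} = (\<Prod>j\<in>J. measure step_sequences (E j))"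
    and "{\<omega> \<in> space walks. \<forall>j\<in>J. \<omega> j \<in> E j} \<in> sets walks"
proof -
  interpret product_prob_space "\<lambda>_::nat. step_sequences" UNIV
    by (intro product_prob_spaceI prob_space_step_sequences)
  have "emeasure walks {\<omega> \<in> space walks. \<forall>j\<in>J. \<omega> j \<in> E j} = (\<Prod>j\<in>J. emeasure step_sequences (E j))"
    unfolding walks_def by (rule emeasure_PiM_Collect) (use assms in auto)
  also have "\<dots> = ennreal (\<Prod>j\<in>J. measure step_sequences (E j))"
    by (simp add: prod_ennreal finite_measure.emeasure_eq_measure
      prob_space.finite_measure prob_space_step_sequences)
  finally show "measure walks {\<omega> \<in> space walks. \<forall>j\<in>J. \<omega> j \<in> E j} = (\<Prod>j\<in>J. measure step_sequences (E j))"
    by (simp add: measure_def prod_nonneg)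
  show "{\<omega> \<in> space walks. \<forall>j\<in>J. \<omega> j \<in> E j} \<in> sets walks"
  proof (rule sets.sets_Collect_finite_All[OF _ \<open>finite J\<close>])
    fix j assume "j \<in> J"
    have "(\<lambda>\<omega>. \<omega> j) \<in> walks \<rightarrow>\<^sub>M step_sequences"
      unfolding walks_def by (rule measurable_component_singleton) simp
    from measurable_sets[OF this assms(2)[OF \<open>j \<in> J\<close>]]
    show "{\<omega> \<in> space walks. \<omega> j \<in> E j} \<in> sets walks"
      by (simp add: vimage_def Int_def conj_commute)
  qed
qed

section \<open>Splitting by settling sites\<close>

text \<open>\<open>None\<close> marks a walk that never leaves the current cluster, the case in
  which \<open>settle\<close> adds no site.\<close>

definition settling_site ::
    "(int ^ 'd) list \<Rightarrow> (nat \<Rightarrow> nat \<Rightarrow> int ^ 'd) \<Rightarrow> nat \<Rightarrow> (int ^ 'd) option" where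
  "settling_site xs \<omega> j =
    (let A = idla_cluster_upto xs \<omega> j; w = trajectory (xs ! j) (\<omega> j)
     in if \<exists>n. w n \<notin> A then Some (w (LEAST n. w n \<notin> A)) else None)"

lemma idla_cluster_upto_Suc_settling:
  "idla_cluster_upto xs \<omega> (Suc j) = set_option (settling_site xs \<omega> j) \<union> idla_cluster_upto xs \<omega> j"
  by (simp add: settling_site_def settle_def Let_def)

lemma idla_cluster_upto_eq_settling_sites:
  "idla_cluster_upto xs \<omega> n = {y. \<exists>j<n. settling_site xs \<omega> j = Some y}"
  by (induction n)
     (auto simp: idla_cluster_upto_Suc_settling less_Suc_eq simp del: idla_cluster_upto.simps(2))

text \<open>A settling site lies outside the cluster built before it, which contains the sites of
  all earlier walks.\<close>

lemma settling_site_inj: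
  assumes "settling_site xs \<omega> i = Some y" "settling_site xs \<omega> j = Some y"
  shows "i = j"
proof -
  have "y \<notin> idla_cluster_upto xs \<omega> j" if "settling_site xs \<omega> j = Some y" for j
    using that LeastI_ex[of "\<lambda>n. trajectory (xs ! j) (\<omega> j) n \<notin> idla_cluster_upto xs \<omega> j"]
    by (auto simp: settling_site_def Let_def split: if_splits)
  then show ?thesis
    using assms unfolding idla_cluster_upto_eq_settling_sites by (metis (mono_tags) linorder_neqE_nat mem_Collect_eq)
qed

text \<open>Until it settles, the walk stays in the cluster of its own time, which every later
  cluster contains. Passing to the later one gives all walks the same confining set.\<close>

lemma settling_site_visit_within:
  assumes "settling_site xs \<omega> j = Some y" "j < n"
  shows "\<omega> j \<in> visit_within (idla_cluster_upto xs \<omega> n) y (xs ! j)"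
proof -
  let ?A = "idla_cluster_upto xs \<omega> j" and ?w = "trajectory (xs ! j) (\<omega> j)"
  define t where "t = (LEAST n. ?w n \<notin> ?A)"
  have y: "?w t = y" using assms by (auto simp: settling_site_def Let_def t_def split: if_splits)
  have "?w i \<in> ?A" if "i < t" for i using not_less_Least that unfolding t_def by blast
  moreover have "?A \<subseteq> idla_cluster_upto xs \<omega> n" "y \<in> idla_cluster_upto xs \<omega> n"
    using assms less_trans unfolding idla_cluster_upto_eq_settling_sites by blast+
  ultimately show ?thesis
    using y unfolding visit_within_def by (force simp: le_less)
qed

text \<open>A discrete intermediate value argument, used with \<open>g\<close> the sup-norm and with
  \<open>g\<close> the distance from the starting site.\<close>

lemma visit_within_image_interval:
  fixes g :: "int ^ 'd \<Rightarrow> nat"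
  assumes s: "s \<in> visit_within \<Lambda> y x" and unit: "\<And>n. s n \<in> unit_steps"
    and g: "\<And>z z'. adjacent z z' \<Longrightarrow> g z' \<le> Suc (g z)"
    and k: "min (g x) (g y) \<le> k" "k \<le> max (g x) (g y)"
  shows "k \<in> g ` \<Lambda>"
proof -
  obtain t where t: "trajectory x s t = y" "\<And>i. i \<le> t \<Longrightarrow> trajectory x s i \<in> \<Lambda>"
    using s by (auto simp: visit_within_def)
  let ?f = "\<lambda>i. int (g (trajectory x s i))"
  have "adjacent (trajectory x s i) (trajectory x s (i + 1))" for i
    using unit by (simp add: adjacent_def trajectory_Suc)
  then have step: "\<bar>?f (i + 1) - ?f i\<bar> \<le> 1" for i
    using g[of "trajectory x s i" "trajectory x s (i + 1)"]
      g[of "trajectory x s (i + 1)" "trajectory x s i"] adjacent_sym by fastforce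
  have "\<exists>i\<le>t. ?f i = int k"
  proof (cases "g x \<le> g y")
    case True
    then show ?thesis
      using k t nat0_intermed_int_val[of t ?f "int k"] step by auto
  next
    case False
    then show ?thesis
      using k t nat0_intermed_int_val[of t "\<lambda>i. - ?f i" "- int k"] step by (fastforce simp: abs_minus_commute)
  qed
  then show ?thesis using t by auto
qed

text \<open>The path attains every distance from 0 to \<open>sup_norm (y - x)\<close> within
  \<open>\<Lambda>\<close>. This limits the settling sites of a walk to a box of polynomial
  size.\<close>

lemma visit_within_dist:
  assumes s: "s \<in> visit_within \<Lambda> y x" and unit: "\<And>n. s n \<in> unit_steps" and "finite \<Lambda>"
  shows "sup_norm (y - x) \<le> card \<Lambda>"
proof -
  have "sup_norm (z' - x) \<le> Suc (sup_norm (z - x))" if "adjacent z z'" for z z'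
    using that adjacent_sup_norm[of "z - x" "z' - x"] by (simp add: adjacent_def)
  then have "{..sup_norm (y - x)} \<subseteq> (\<lambda>z. sup_norm (z - x)) ` \<Lambda>"
    using visit_within_image_interval[OF s unit, of "\<lambda>z. sup_norm (z - x)"] by auto
  then have "card {..sup_norm (y - x)} \<le> card \<Lambda>"
    using \<open>finite \<Lambda>\<close> by (meson card_image_le card_mono finite_imageI le_trans)
  then show ?thesis by simp
qed

text \<open>The event that the cluster covers the origin is split according to the settling site of
  each walk. Once these sites are prescribed, each walk has to reach its site before leaving the
  final cluster, and these requirements concern independent walks.\<close>

lemma idla_origin_union_bound:
  fixes xs :: "(int ^ 'd) list" and C D :: real
  defines "N \<equiv> length xs"
  assumes C: "C \<ge> 1"
    and start: "\<And>x. x \<in> set xs \<Longrightarrow> R \<le> sup_norm x"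
    and bound: "\<And>\<Lambda>. finite \<Lambda> \<Longrightarrow> card \<Lambda> \<le> N \<Longrightarrow> {..R} \<subseteq> sup_norm ` \<Lambda> \<Longrightarrow>
       \<exists>S. (\<forall>y\<in>\<Lambda>. \<forall>x\<in>set xs. visit_prob \<Lambda> y x \<le> C * exp (- S y)) \<and> D \<le> (\<Sum>y\<in>\<Lambda>. S y)"
  shows "measure walks {\<omega> \<in> space walks. 0 \<in> idla_cluster xs \<omega>}
    \<le> real ((2 * N + 1) ^ CARD('d) + 1) ^ N * C ^ N * exp (- D)"
proof -
  \<comment> \<open>Radius \<open>N\<close> suffices by \<open>visit_within_dist\<close>, since the
    cluster has at most \<open>N\<close> sites.\<close>
  define Opt where "Opt j = insert None (Some ` {y. sup_norm (y - xs ! j) \<le> N})" for j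
  define sites where "sites \<sigma> = {y. \<exists>j<N. \<sigma> j = Some y}" for \<sigma> :: "nat \<Rightarrow> (int ^ 'd) option"
  \<comment> \<open>Both conditions hold for the true settling sites when the origin is covered. The
    first is what \<open>bound\<close> requires, the second puts settled walks and sites in
    bijection.\<close>
  define \<Sigma> where "\<Sigma> = {\<sigma> \<in> Pi\<^sub>E {..<N} Opt.
     {..R} \<subseteq> sup_norm ` sites \<sigma> \<and> inj_on \<sigma> {j. j < N \<and> \<sigma> j \<noteq> None}}"
  define E where "E \<sigma> = {\<omega> \<in> space walks. \<forall>j\<in>{j. j < N \<and> \<sigma> j \<noteq> None}.
     \<omega> j \<in> visit_within (sites \<sigma>) (the (\<sigma> j)) (xs ! j)}" for \<sigma>
  have card_Opt: "finite (Opt j)" "card (Opt j) \<le> (2 * N + 1) ^ CARD('d) + 1" for j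
  proof -
    have eq: "{y. sup_norm (y - xs ! j) \<le> N} = (\<lambda>z. z + xs ! j) ` {z. sup_norm z \<le> N}"
      by (auto simp: image_iff intro!: exI[of _ "_ - xs ! j"])
    then show "finite (Opt j)" by (simp add: Opt_def)
    have "card (Opt j) \<le> Suc (card (Some ` {y. sup_norm (y - xs ! j) \<le> N}))"
      unfolding Opt_def by (rule card_insert_le_m1) auto
    also have "\<dots> \<le> Suc (card {z :: int ^ 'd. sup_norm z \<le> N})"
      by (simp add: eq card_image inj_on_def)
    finally show "card (Opt j) \<le> (2 * N + 1) ^ CARD('d) + 1"
      using card_sup_ball_le[of N] by (metis Suc_eq_plus1 Suc_le_mono le_trans)
  qed
  have fin_PiE: "finite (Pi\<^sub>E {..<N} Opt)" using card_Opt by (intro finite_PiE) auto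
  have fin: "finite \<Sigma>" unfolding \<Sigma>_def using fin_PiE by simp
  have "card \<Sigma> \<le> card (Pi\<^sub>E {..<N} Opt)" unfolding \<Sigma>_def using fin_PiE by (intro card_mono) auto
  also have "\<dots> \<le> ((2 * N + 1) ^ CARD('d) + 1) ^ N"
    using prod_mono[of "{..<N}" "\<lambda>j. card (Opt j)" "\<lambda>_. (2 * N + 1) ^ CARD('d) + 1"] card_Opt
    by (simp add: card_PiE)
  finally have card_\<Sigma>: "card \<Sigma> \<le> ((2 * N + 1) ^ CARD('d) + 1) ^ N" .
  have E_sets: "E \<sigma> \<in> sets walks" for \<sigma>
    unfolding E_def by (rule walks_prob_Collect) (auto intro: sets_visit_within)
  have E_prob: "measure walks (E \<sigma>) \<le> C ^ N * exp (- D)" if \<sigma>: "\<sigma> \<in> \<Sigma>" for \<sigma>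
  proof -
    define J where "J = {j. j < N \<and> \<sigma> j \<noteq> None}"
    have finJ: "finite J" and cardJ: "card J \<le> N"
      using card_mono[of "{..<N}" J] by (auto simp: J_def)
    have bij: "bij_betw (\<lambda>j. the (\<sigma> j)) J (sites \<sigma>)"
    proof (rule bij_betw_imageI)
      show "inj_on (\<lambda>j. the (\<sigma> j)) J"
        using \<sigma> by (auto simp: \<Sigma>_def J_def inj_on_def)
      show "(\<lambda>j. the (\<sigma> j)) ` J = sites \<sigma>" by (force simp: J_def sites_def image_iff)
    qed
    have sites: "finite (sites \<sigma>)" "card (sites \<sigma>) \<le> N"
      using bij_betw_finite[OF bij] bij_betw_same_card[OF bij] finJ cardJ by auto
    obtain S where S: "\<And>y x. y \<in> sites \<sigma> \<Longrightarrow> x \<in> set xs \<Longrightarrow> visit_prob (sites \<sigma>) y x \<le> C * exp (- S y)"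
      "D \<le> (\<Sum>y\<in>sites \<sigma>. S y)"
      using bound[OF sites] \<sigma> unfolding \<Sigma>_def by blast
    have "measure walks (E \<sigma>) = (\<Prod>j\<in>J. visit_prob (sites \<sigma>) (the (\<sigma> j)) (xs ! j))"
      unfolding E_def visit_prob_def J_def[symmetric]
      using finJ by (intro walks_prob_Collect) (auto intro: sets_visit_within)
    also have "\<dots> \<le> (\<Prod>j\<in>J. C * exp (- S (the (\<sigma> j))))"
    proof (intro prod_mono conjI)
      fix j assume j: "j \<in> J"
      show "visit_prob (sites \<sigma>) (the (\<sigma> j)) (xs ! j) \<le> C * exp (- S (the (\<sigma> j)))"
        using j by (intro S) (auto simp: J_def sites_def N_def)
    qed (simp add: visit_prob_def)
    also have "\<dots> = C ^ card J * exp (- (\<Sum>j\<in>J. S (the (\<sigma> j))))"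
      using finJ by (simp add: prod.distrib exp_sum sum_negf[symmetric])
    \<comment> \<open>The bijection turns the cost of the walks into the cost of filling the
      set.\<close>
    also have "(\<Sum>j\<in>J. S (the (\<sigma> j))) = (\<Sum>y\<in>sites \<sigma>. S y)"
      by (rule sum.reindex_bij_betw[OF bij])
    \<comment> \<open>\<open>C \<ge> 1\<close> pads the exponent from the settled walks to all
      \<open>N\<close>.\<close>
    also have "C ^ card J * exp (- (\<Sum>y\<in>sites \<sigma>. S y)) \<le> C ^ N * exp (- D)"
      using C cardJ S(2) by (intro mult_mono power_increasing) auto
    finally show ?thesis .
  qed
  interpret prob_space walks by (rule prob_space_walks)
  have "measure walks {\<omega> \<in> space walks. 0 \<in> idla_cluster xs \<omega>} \<le> measure walks (\<Union>\<sigma>\<in>\<Sigma>. E \<sigma>)"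
  proof (rule finite_measure_mono_AE)
    show "(\<Union>\<sigma>\<in>\<Sigma>. E \<sigma>) \<in> sets walks" using fin E_sets by auto
    show "AE \<omega> in walks. \<omega> \<in> {\<omega> \<in> space walks. 0 \<in> idla_cluster xs \<omega>} \<longrightarrow> \<omega> \<in> (\<Union>\<sigma>\<in>\<Sigma>. E \<sigma>)"
      using AE_walks_unit_steps
    proof (eventually_elim, safe)
      fix \<omega> assume unit: "\<forall>j n. \<omega> j n \<in> (unit_steps :: (int ^ 'd) set)"
        and sp: "\<omega> \<in> space walks" and 0: "0 \<in> idla_cluster xs \<omega>"
      \<comment> \<open>An outcome that covers the origin lies in the event of its own settling
        sites.\<close>
      define \<sigma> where "\<sigma> = restrict (settling_site xs \<omega>) {..<N}"
      have sites: "sites \<sigma> = idla_cluster_upto xs \<omega> N"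
        by (auto simp: sites_def \<sigma>_def idla_cluster_upto_eq_settling_sites)
      have within: "\<omega> j \<in> visit_within (sites \<sigma>) y (xs ! j)" if "j < N" "settling_site xs \<omega> j = Some y" for j y
        unfolding sites by (rule settling_site_visit_within) (use that in auto)
      have fin_sites: "finite (sites \<sigma>)" unfolding sites by (rule finite_idla_cluster_upto)
      have "sites \<sigma> \<subseteq> (\<lambda>j. the (\<sigma> j)) ` {..<N}" by (force simp: sites_def image_iff)
      then have card_sites: "card (sites \<sigma>) \<le> N"
        by (metis card_lessThan finite_lessThan surj_card_le)
      have "\<sigma> \<in> \<Sigma>"
        unfolding \<Sigma>_def
      proof (intro CollectI conjI)
        show "\<sigma> \<in> Pi\<^sub>E {..<N} Opt"
        proof (rule PiE_I)
          fix j assume j: "j \<in> {..<N}"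
          show "\<sigma> j \<in> Opt j"
          proof (cases "settling_site xs \<omega> j")
            case (Some y)
            then have "sup_norm (y - xs ! j) \<le> card (sites \<sigma>)"
              using j unit by (intro visit_within_dist[OF within] fin_sites) auto
            then show ?thesis using Some j card_sites by (auto simp: \<sigma>_def Opt_def)
          qed (use j in \<open>auto simp: \<sigma>_def Opt_def\<close>)
        qed (simp add: \<sigma>_def)
        show "inj_on \<sigma> {j. j < N \<and> \<sigma> j \<noteq> None}"
          by (auto simp: inj_on_def \<sigma>_def intro: settling_site_inj)
        \<comment> \<open>The walk that settles at the origin starts on or outside the sphere of
          radius \<open>R\<close>, so its path within the cluster meets all spheres up to
          \<open>R\<close>.\<close>
        obtain j where j: "j < N" "settling_site xs \<omega> j = Some 0"
          using 0 by (auto simp: idla_cluster_def idla_cluster_upto_eq_settling_sites N_def)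
        have "R \<le> sup_norm (xs ! j)" using start j by (simp add: N_def)
        then have "k \<in> sup_norm ` sites \<sigma>" if "k \<le> R" for k
          by (intro visit_within_image_interval[OF within[OF j]])
             (use unit that in \<open>auto intro: adjacent_sup_norm\<close>)
        then show "{..R} \<subseteq> sup_norm ` sites \<sigma>" by auto
      qed
      moreover have "\<omega> \<in> E \<sigma>"
        using sp within by (auto simp: E_def \<sigma>_def)
      ultimately show "\<omega> \<in> (\<Union>\<sigma>\<in>\<Sigma>. E \<sigma>)" by blast
    qed
  qed
  also have "\<dots> \<le> (\<Sum>\<sigma>\<in>\<Sigma>. measure walks (E \<sigma>))"
    using fin E_sets by (intro measure_UNION_le) auto
  also have "\<dots> \<le> (\<Sum>\<sigma>\<in>\<Sigma>. C ^ N * exp (- D))" by (intro sum_mono E_prob)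
  also have "\<dots> = real (card \<Sigma>) * (C ^ N * exp (- D))" by simp
  also have "\<dots> \<le> real (((2 * N + 1) ^ CARD('d) + 1) ^ N) * (C ^ N * exp (- D))"
    using card_\<Sigma> C by (intro mult_right_mono) (simp_all only: of_nat_le_iff, simp)
  finally show ?thesis by (simp add: mult.assoc)
qed

section \<open>The total weight of a cluster\<close>

lemma card_ordered_pairs:
  fixes A :: "nat set"
  assumes "finite A"
  shows "2 * real (card {(k, i). k \<in> A \<and> i \<in> A \<and> k < i}) = (real (card A))\<^sup>2 - card A"
proof -
  let ?P = "{(k, i). k \<in> A \<and> i \<in> A \<and> k < i}"
  let ?S = "prod.swap ` ?P" and ?I = "(\<lambda>k. (k, k)) ` A"
  have fin: "finite ?P" by (rule finite_subset[of _ "A \<times> A"]) (use assms in auto)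
  have "A \<times> A = (?P \<union> ?S) \<union> ?I" by (auto simp: image_iff)
  then have "card A * card A = card ((?P \<union> ?S) \<union> ?I)" by (simp flip: card_cartesian_product)
  also have "\<dots> = card (?P \<union> ?S) + card ?I"
    using fin assms by (intro card_Un_disjoint) auto
  also have "card (?P \<union> ?S) = card ?P + card ?S"
    using fin by (intro card_Un_disjoint) auto
  finally have "card A * card A = 2 * card ?P + card A" by (simp add: card_image inj_on_def)
  then have "real (card A * card A) = real (2 * card ?P + card A)" by (simp only:)
  then show ?thesis by (simp add: power2_eq_square)
qed

text \<open>Only pairs whose values lie in the same dyadic class are counted. This loses a factor of
  the number of classes when \<open>p = 2\<close> (dimension two), and only a constant when \<open>p = 1\<close>.\<close>

lemma dyadic_pairs_bound:
  fixes m :: "nat \<Rightarrow> nat" and p L :: nat and \<rho> :: real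
  assumes fin: "finite G" and m: "\<And>i. i \<in> G \<Longrightarrow> 1 \<le> m i \<and> m i < 2 ^ L" and p: "p \<le> 2"
  defines "\<rho> \<equiv> 2 / sqrt (2 ^ p)"
  shows "(real (card G))\<^sup>2 / (\<Sum>l<L. inverse \<rho> ^ l) - \<rho> ^ L * card G
    \<le> 4 * (\<Sum>(k, i) | k \<in> G \<and> i \<in> G \<and> k < i. real (m k) / sqrt (real (m i) ^ p))"
proof (cases "G = {}")
  case False
  have sqrt2p: "0 < sqrt (2 ^ p)" "sqrt (2 ^ p) \<le> 2"
  proof -
    have "(2::real) ^ p \<le> 2 ^ 2" using p by (intro power_increasing) auto
    then show "sqrt (2 ^ p) \<le> 2" by (intro real_le_lsqrt) auto
  qed simp
  have \<rho>: "1 \<le> \<rho>" using sqrt2p by (simp add: \<rho>_def field_simps)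
  have "\<exists>l. 2 ^ l \<le> m i \<and> m i < 2 ^ (l + 1)" if "i \<in> G" for i
    using ex_power_ivl1[of 2 "m i"] m[OF that] by simp
  then obtain c where c: "\<And>i. i \<in> G \<Longrightarrow> 2 ^ c i \<le> m i \<and> m i < 2 ^ (c i + 1)" by metis
  have c_less: "c i < L" if "i \<in> G" for i
    using c[OF that] m[OF that] by (metis le_less_trans nat_power_less_imp_less pos2)
  define A where "A l = {i \<in> G. c i = l}" for l
  define f where "f l = real (card (A l))" for l
  let ?P = "\<lambda>A :: nat set. {(k, i). k \<in> A \<and> i \<in> A \<and> k < i}"
  let ?t = "\<lambda>(k, i). real (m k) / sqrt (real (m i) ^ p)"
  have finA: "finite (A l)" for l using fin by (simp add: A_def)
  have finP: "finite (?P A)" if "finite A" for A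
    by (rule finite_subset[of _ "A \<times> A"]) (use that in auto)
  \<comment> \<open>If both values lie in class \<open>l\<close>, the term is at least
    \<open>2^l / sqrt (2^p)^(l+1)\<close>, a gain of order \<open>\<rho>^l\<close>. For
    \<open>p = 2\<close> this is 1 in every class, for \<open>p = 1\<close> it grows
    geometrically.\<close>
  have pair_term: "\<rho> ^ l / 2 \<le> real (m k) / sqrt (real (m i) ^ p)" if "k \<in> A l" "i \<in> A l" for k i l
  proof -
    have k: "2 ^ l \<le> real (m k)" and i: "1 \<le> real (m i)" "real (m i) \<le> 2 ^ (l + 1)"
    proof -
      have *: "2 ^ l \<le> m k" "m i \<le> 2 ^ (l + 1)" "1 \<le> m i"
        using that c m by (fastforce simp: A_def)+
      show "2 ^ l \<le> real (m k)" "1 \<le> real (m i)" "real (m i) \<le> 2 ^ (l + 1)"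
        using *(1)[THEN of_nat_mono[where 'a = real]] *(2)[THEN of_nat_mono[where 'a = real]]
          *(3)[THEN of_nat_mono[where 'a = real]] by simp_all
    qed
    have "sqrt (real (m i) ^ p) \<le> sqrt ((2 ^ (l + 1)) ^ p)"
      using i by (intro real_sqrt_le_mono power_mono) auto
    also have "\<dots> = sqrt (2 ^ p) ^ (l + 1)"
      by (simp add: real_sqrt_power[symmetric] real_sqrt_mult power_mult[symmetric] mult.commute)
    finally have "2 ^ l / sqrt (2 ^ p) ^ (l + 1) \<le> real (m k) / sqrt (real (m i) ^ p)"
      using k i by (intro frac_le) auto
    moreover have "\<rho> ^ l / 2 \<le> \<rho> ^ l / sqrt (2 ^ p)"
      using sqrt2p \<rho> by (intro divide_left_mono) auto
    moreover have "\<rho> ^ l / sqrt (2 ^ p) = 2 ^ l / sqrt (2 ^ p) ^ (l + 1)"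
      by (simp add: \<rho>_def power_divide)
    ultimately show ?thesis by linarith
  qed
  have class_pairs: "\<rho> ^ l * ((f l)\<^sup>2 - f l) \<le> 4 * sum ?t (?P (A l))" for l
  proof -
    have "real (card (?P (A l))) * (\<rho> ^ l / 2) \<le> sum ?t (?P (A l))"
      using pair_term by (intro sum_bounded_below) auto
    moreover have "(f l)\<^sup>2 - f l = 2 * real (card (?P (A l)))"
      using card_ordered_pairs[OF finA[of l]] by (simp add: f_def)
    ultimately show ?thesis by (simp add: mult.commute)
  qed
  have cardG: "real (card G) = (\<Sum>l<L. f l)"
  proof -
    have "(\<Sum>l<L. \<Sum>i\<in>{i. i \<in> G \<and> c i = l}. 1) = (\<Sum>i\<in>G. 1 :: real)"
      using fin c_less by (intro sum.group) auto
    then show ?thesis by (simp add: f_def A_def)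
  qed
  let ?Z = "\<Sum>l<L. inverse \<rho> ^ l"
  have Lpos: "0 < L" using False c_less by fastforce
  have Z: "0 < ?Z" using \<rho> Lpos by (intro sum_pos) auto
  \<comment> \<open>Weighted Cauchy-Schwarz: the squared total is at most the gain of all classes
    times the sum of the inverse weights.\<close>
  have "(\<Sum>l<L. f l)\<^sup>2 = (\<Sum>l<L. (sqrt (\<rho> ^ l) * f l) * sqrt (inverse \<rho> ^ l))\<^sup>2"
    using \<rho> by (intro arg_cong[where f = "\<lambda>x. x\<^sup>2"] sum.cong)
      (auto simp: real_sqrt_mult[symmetric] power_mult_distrib[symmetric] mult.commute mult.left_commute)
  also have "\<dots> \<le> (\<Sum>l<L. (sqrt (\<rho> ^ l) * f l)\<^sup>2) * (\<Sum>l<L. (sqrt (inverse \<rho> ^ l))\<^sup>2)"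
    by (rule Cauchy_Schwarz_ineq_sum)
  also have "\<dots> = (\<Sum>l<L. \<rho> ^ l * (f l)\<^sup>2) * ?Z"
    using \<rho> by (simp add: power_mult_distrib)
  finally have CS: "(real (card G))\<^sup>2 / ?Z \<le> (\<Sum>l<L. \<rho> ^ l * (f l)\<^sup>2)"
    using Z by (simp add: cardG divide_le_eq)
  \<comment> \<open>The missing diagonal pairs cost at most
    \<open>\<rho>^L * card G\<close>.\<close>
  have "(\<Sum>l<L. \<rho> ^ l * f l) \<le> (\<Sum>l<L. \<rho> ^ L * f l)"
    using \<rho> by (intro sum_mono mult_right_mono power_increasing) (auto simp: f_def)
  then have "(real (card G))\<^sup>2 / ?Z - \<rho> ^ L * card G \<le> (\<Sum>l<L. \<rho> ^ l * ((f l)\<^sup>2 - f l))"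
    using CS by (simp add: cardG right_diff_distrib sum_subtractf sum_distrib_left)
  also have "\<dots> \<le> (\<Sum>l<L. 4 * sum ?t (?P (A l)))" by (intro sum_mono class_pairs)
  also have "\<dots> = 4 * sum ?t (\<Union>l<L. ?P (A l))"
    unfolding sum_distrib_left[symmetric]
    by (subst sum.UNION_disjoint, simp, simp add: finP finA, auto simp: A_def)
  also have "\<dots> \<le> 4 * sum ?t (?P G)"
    using fin by (intro mult_left_mono sum_mono2 finP) (auto simp: A_def)
  finally show ?thesis .
qed simp

text \<open>A step between the shells \<open>k\<close> and \<open>k + 1\<close> may be charged to either of them, so the slope of
  the weight there has to be admissible for both. A shell with more than \<open>2 * K\<close> cluster sites may
  contain a full lattice line, which rules out the Poincare inequality, so it gets no slope.\<close>

definition pair_count :: "(nat \<Rightarrow> nat) \<Rightarrow> nat \<Rightarrow> nat" where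
  "pair_count n k = n k + n (Suc k)"

definition shell_slope :: "nat \<Rightarrow> real \<Rightarrow> nat \<Rightarrow> (nat \<Rightarrow> nat) \<Rightarrow> nat \<Rightarrow> real" where
  "shell_slope p \<epsilon> K n k =
    (if K \<le> k \<and> k < 2 * K \<and> pair_count n k \<le> 2 * K then \<epsilon> / sqrt (real (pair_count n k) ^ p) else 0)"

text \<open>The decay accumulated between the sphere of radius \<open>2 * K\<close>, where the
  weight vanishes, and the sphere of radius \<open>k\<close>.\<close>

definition shell_weight :: "nat \<Rightarrow> real \<Rightarrow> nat \<Rightarrow> (nat \<Rightarrow> nat) \<Rightarrow> nat \<Rightarrow> real" where
  "shell_weight p \<epsilon> K n k = (\<Sum>i\<in>{k..<2 * K}. shell_slope p \<epsilon> K n i)"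

lemma shell_slope_nonneg: "0 \<le> \<epsilon> \<Longrightarrow> 0 \<le> shell_slope p \<epsilon> K n k"
  by (simp add: shell_slope_def)

lemma shell_weight_nonneg: "0 \<le> \<epsilon> \<Longrightarrow> 0 \<le> shell_weight p \<epsilon> K n k"
  unfolding shell_weight_def by (intro sum_nonneg shell_slope_nonneg)

lemma shell_weight_Suc: "shell_weight p \<epsilon> K n k = shell_slope p \<epsilon> K n k + shell_weight p \<epsilon> K n (Suc k)"
proof (cases "k < 2 * K")
  case True
  then show ?thesis unfolding shell_weight_def by (simp add: sum.atLeast_Suc_lessThan)
qed (simp add: shell_weight_def shell_slope_def)

lemma shell_weight_eq_0: "2 * K \<le> k \<Longrightarrow> shell_weight p \<epsilon> K n k = 0"
  by (simp add: shell_weight_def)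

text \<open>At least half of the radii carry admissible pairs, and \<open>dyadic_pairs_bound\<close>
  applies to their pair counts. Its factor 4, doubled because a shell belongs to two pairs, gives
  the 8.\<close>

lemma total_shell_weight_ge:
  fixes n :: "nat \<Rightarrow> nat" and p K L N :: nat and \<rho> :: real
  assumes \<epsilon>: "0 \<le> \<epsilon>" and p: "p \<le> 2" and K: "1 \<le> K"
    and n: "\<And>k. k \<le> 2 * K \<Longrightarrow> 1 \<le> n k" "(\<Sum>k\<in>{K..2 * K}. n k) \<le> N" "2 * N \<le> K\<^sup>2"
    and L: "2 * K < 2 ^ L"
  defines "\<rho> \<equiv> 2 / sqrt (2 ^ p)"
  shows "\<epsilon> / 8 * (K\<^sup>2 / (4 * (\<Sum>l<L. inverse \<rho> ^ l)) - \<rho> ^ L * K)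
    \<le> (\<Sum>k\<in>{K..<2 * K}. n k * shell_weight p \<epsilon> K n k)"
proof -
  let ?m = "pair_count n" and ?s = "shell_weight p \<epsilon> K n" and ?Z = "\<Sum>l<L. inverse \<rho> ^ l"
  define G where "G = {k \<in> {K..<2 * K}. ?m k \<le> 2 * K}"
  let ?bad = "{k \<in> {K..<2 * K}. \<not> ?m k \<le> 2 * K}"
  have antimono: "?s (Suc k) \<le> ?s k" for k
    using shell_weight_Suc[of p \<epsilon> K n k] shell_slope_nonneg[OF \<epsilon>, of p K n k] by simp
  have \<rho>: "0 < \<rho>" by (simp add: \<rho>_def)
  \<comment> \<open>A bad pair has more than \<open>2 * K\<close> sites, while all pairs together
    have at most \<open>2 * N \<le> K^2\<close>. Thus at most \<open>K / 2\<close> radii are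
    bad.\<close>
  have "card ?bad * (2 * K) \<le> (\<Sum>k\<in>?bad. ?m k)" by (intro sum_bounded_below[of _ _ ?m, simplified]) auto
  also have "\<dots> \<le> (\<Sum>k\<in>{K..<2 * K}. ?m k)" by (intro sum_mono2) auto
  also have "\<dots> = (\<Sum>k\<in>{K..<2 * K}. n k) + (\<Sum>k\<in>{K..<2 * K}. n (Suc k))"
    by (simp add: pair_count_def sum.distrib)
  also have "(\<Sum>k\<in>{K..<2 * K}. n (Suc k)) = (\<Sum>k\<in>{Suc K..<Suc (2 * K)}. n k)"
    by (rule sum.shift_bounds_Suc_ivl[symmetric])
  also have "(\<Sum>k\<in>{K..<2 * K}. n k) + \<dots> \<le> (\<Sum>k\<in>{K..2 * K}. n k) + (\<Sum>k\<in>{K..2 * K}. n k)"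
    by (intro add_mono sum_mono2) auto
  also have "\<dots> \<le> K * K" using n(2,3) by (simp add: power2_eq_square)
  finally have bad: "2 * card ?bad \<le> K" using K by simp
  have "card G + card ?bad = card (G \<union> ?bad)"
    by (intro card_Un_disjoint[symmetric]) (auto simp: G_def)
  also have "G \<union> ?bad = {K..<2 * K}" by (auto simp: G_def)
  finally have cardG: "K \<le> 2 * card G" "card G \<le> K" using bad by auto
  have finG: "finite G" by (simp add: G_def)
  have mG: "1 \<le> ?m i \<and> ?m i < 2 ^ L" if "i \<in> G" for i
    using that n(1)[of i] L by (auto simp: G_def pair_count_def)
  have Lpos: "0 < L" using L K by (cases L) auto
  have Z: "0 < ?Z" using \<rho> Lpos by (intro sum_pos) auto
  have "K\<^sup>2 / (4 * ?Z) - \<rho> ^ L * K \<le> (real (card G))\<^sup>2 / ?Z - \<rho> ^ L * card G"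
  proof (rule diff_mono)
    have "(real K)\<^sup>2 \<le> (2 * real (card G))\<^sup>2" using cardG(1) by (intro power_mono) auto
    then have "(real K)\<^sup>2 / 4 / ?Z \<le> (real (card G))\<^sup>2 / ?Z"
      using Z by (intro divide_right_mono) (auto simp: power_mult_distrib)
    then show "K\<^sup>2 / (4 * ?Z) \<le> (real (card G))\<^sup>2 / ?Z" by simp
    show "\<rho> ^ L * card G \<le> \<rho> ^ L * K" using cardG \<rho> by (intro mult_left_mono) auto
  qed
  also have "\<dots> \<le> 4 * (\<Sum>(k, i) | k \<in> G \<and> i \<in> G \<and> k < i. real (?m k) / sqrt (real (?m i) ^ p))"
    unfolding \<rho>_def by (rule dyadic_pairs_bound[OF finG mG p])
  finally have pairs: "\<epsilon> * (K\<^sup>2 / (4 * ?Z) - \<rho> ^ L * K)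
      \<le> \<epsilon> * (4 * (\<Sum>(k, i) | k \<in> G \<and> i \<in> G \<and> k < i. real (?m k) / sqrt (real (?m i) ^ p)))"
    using \<epsilon> by (rule mult_left_mono)
  have "\<epsilon> * (\<Sum>(k, i) | k \<in> G \<and> i \<in> G \<and> k < i. real (?m k) / sqrt (real (?m i) ^ p))
      = (\<Sum>(k, i) | k \<in> G \<and> i \<in> G \<and> k < i. ?m k * shell_slope p \<epsilon> K n i)"
    unfolding sum_distrib_left by (intro sum.cong) (auto simp: G_def shell_slope_def)
  also have "\<dots> \<le> (\<Sum>(k, i)\<in>(SIGMA k:{K..<2 * K}. {Suc k..<2 * K}). ?m k * shell_slope p \<epsilon> K n i)"
    using \<epsilon> by (intro sum_mono2) (auto simp: G_def intro!: mult_nonneg_nonneg shell_slope_nonneg)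
  \<comment> \<open>For fixed \<open>k\<close> the slopes at the radii \<open>i > k\<close> add up
    to the weight at \<open>Suc k\<close>.\<close>
  also have "\<dots> = (\<Sum>k\<in>{K..<2 * K}. ?m k * ?s (Suc k))"
    by (subst sum.Sigma[symmetric]) (auto simp: shell_weight_def sum_distrib_left)
  also have "\<dots> = (\<Sum>k\<in>{K..<2 * K}. n k * ?s (Suc k)) + (\<Sum>k\<in>{K..<2 * K}. n (Suc k) * ?s (Suc k))"
    by (simp add: pair_count_def distrib_right sum.distrib)
  also have "(\<Sum>k\<in>{K..<2 * K}. n (Suc k) * ?s (Suc k)) = (\<Sum>k\<in>{Suc K..<Suc (2 * K)}. n k * ?s k)"
    by (rule sum.shift_bounds_Suc_ivl[symmetric])
  \<comment> \<open>The shifted range ends at \<open>2 * K\<close>, where the weight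
    vanishes.\<close>
  also have "\<dots> = (\<Sum>k\<in>{Suc K..<2 * K}. n k * ?s k)"
    by (intro sum.mono_neutral_right) (auto simp: shell_weight_eq_0)
  also have "\<dots> \<le> (\<Sum>k\<in>{K..<2 * K}. n k * ?s k)"
    using \<epsilon> by (intro sum_mono2) (auto intro!: mult_nonneg_nonneg shell_weight_nonneg)
  also have "(\<Sum>k\<in>{K..<2 * K}. n k * ?s (Suc k)) \<le> (\<Sum>k\<in>{K..<2 * K}. n k * ?s k)"
    by (intro sum_mono mult_left_mono antimono) simp
  finally show ?thesis using pairs by simp
qed

section \<open>The origin is rarely covered\<close>

text \<open>The Agmon estimate for \<open>h = visit_prob \<Lambda> y\<close> and \<open>s\<close>
  the shell weight, which vanishes at the starting site \<open>x\<close>.\<close>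

lemma visit_prob_decay:
  fixes \<Lambda> :: "(int ^ 'd) set" and K p :: nat
  defines "n \<equiv> \<lambda>k. card (\<Lambda> \<inter> shell k)"
  assumes p: "p = 2 \<and> CARD('d) \<ge> 2 \<or> p = 1 \<and> CARD('d) \<ge> 3"
    and fin: "finite \<Lambda>" and full: "\<And>k. k \<le> 2 * K \<Longrightarrow> 1 \<le> n k"
    and y: "y \<in> \<Lambda>" and x: "2 * K \<le> sup_norm x"
  shows "visit_prob \<Lambda> y x
    \<le> (16 * CARD('d) * card \<Lambda>) * exp (- shell_weight p (1 / (6 * real CARD('d))) K n (sup_norm y))"
proof (cases "x \<in> \<Lambda>")
  case False
  then show ?thesis by (simp add: visit_prob_outside)
next
  case True
  \<comment> \<open>This makes \<open>8 * CARD('d) * 4 * CARD('d) * \<epsilon>^2\<close> equal to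
    \<open>32 / 36\<close>, just below the 1 that the Agmon estimate allows.\<close>
  define \<epsilon> where "\<epsilon> = 1 / (6 * real CARD('d))"
  have d: "1 \<le> real CARD('d)" by (simp add: Suc_le_eq)
  have "1 \<le> 6 * real CARD('d)" using d by linarith
  then have \<epsilon>: "0 < \<epsilon>" "\<epsilon> \<le> 1" unfolding \<epsilon>_def by (simp_all only: divide_le_eq_1_pos) simp_all
  define \<gamma> where "\<gamma> k = (if n k \<le> 2 * k then \<epsilon> / sqrt (real (n k) ^ p) else 0)" for k
  have \<gamma>0: "0 \<le> \<gamma> k" for k using \<epsilon> by (simp add: \<gamma>_def)
  have \<gamma>1: "\<gamma> k \<le> 1" for k
  proof (cases "n k = 0")
    case False
    then have "1 \<le> sqrt (real (n k) ^ p)" by simp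
    then have "\<epsilon> / sqrt (real (n k) ^ p) \<le> 1 / 1" using \<epsilon> by (intro frac_le) auto
    then show ?thesis by (simp add: \<gamma>_def)
  qed (use \<epsilon> p in \<open>auto simp: \<gamma>_def\<close>)
  \<comment> \<open>A positive slope needs \<open>pair_count n k \<le> 2 * K\<close> and
    \<open>K \<le> k\<close>, so both shells satisfy the condition \<open>n k' \<le> 2 * k'\<close>
    in \<open>\<gamma>\<close>, and the larger pair count only lowers the slope.\<close>
  have slope_le: "shell_slope p \<epsilon> K n k \<le> \<gamma> k'" if k': "k' = k \<or> k' = Suc k" for k k'
  proof (cases "K \<le> k \<and> k < 2 * K \<and> pair_count n k \<le> 2 * K")
    case True
    have "n k' \<le> pair_count n k" using k' by (auto simp: pair_count_def)
    moreover have "1 \<le> n k'" using full[of k'] k' True by auto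
    moreover have "K \<le> k'" using True k' by auto
    ultimately show ?thesis
      using True \<epsilon> by (auto simp: shell_slope_def \<gamma>_def intro!: divide_left_mono power_mono mult_pos_pos)
  next
    case False
    then show ?thesis using \<gamma>0 by (auto simp: shell_slope_def)
  qed
  have diff: "\<bar>shell_weight p \<epsilon> K n (Suc k) - shell_weight p \<epsilon> K n k\<bar> = shell_slope p \<epsilon> K n k" for k
    using shell_weight_Suc[of p \<epsilon> K n k] shell_slope_nonneg[of \<epsilon> p K n k] \<epsilon> by simp
  have "(visit_prob \<Lambda> y x)\<^sup>2 \<le> 16 * CARD('d) * card \<Lambda> *
      exp (2 * shell_weight p \<epsilon> K n (sup_norm x) - 2 * shell_weight p \<epsilon> K n (sup_norm y))"
  proof (rule agmon_estimate[where \<gamma> = \<gamma>, OF fin y True])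
    fix k and v :: "int ^ 'd \<Rightarrow> real" assume v: "\<And>z. z \<notin> \<Lambda> \<Longrightarrow> v z = 0"
    let ?V = "\<Sum>z\<in>shell k. (v z)\<^sup>2" and ?E = "dirichlet_energy (shell k) v"
    show "8 * CARD('d) * (\<gamma> k)\<^sup>2 * ?V \<le> ?E"
    proof (cases "n k \<le> 2 * k \<and> n k \<noteq> 0")
      case True
      have V: "?V \<le> 4 * CARD('d) * real (n k) ^ p * ?E"
        using p
      proof (elim disjE conjE)
        assume "p = 2" "CARD('d) \<ge> 2"
        then have "?V \<le> 2 * real (n k) ^ p * ?E"
          using shell_poincare_line[OF _ fin v] True by (simp add: n_def)
        also have "\<dots> \<le> 4 * CARD('d) * real (n k) ^ p * ?E"
          by (intro mult_right_mono dirichlet_energy_nonneg) (use d in linarith, simp)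
        finally show ?thesis .
      next
        assume "p = 1" "CARD('d) \<ge> 3"
        then show ?thesis using shell_poincare_plane[OF _ fin v] True by (simp add: n_def)
      qed
      have \<gamma>2: "(\<gamma> k)\<^sup>2 * real (n k) ^ p = \<epsilon>\<^sup>2"
        using True by (simp add: \<gamma>_def power_divide)
      have "8 * CARD('d) * (\<gamma> k)\<^sup>2 * ?V \<le> 8 * CARD('d) * (\<gamma> k)\<^sup>2 * (4 * CARD('d) * real (n k) ^ p * ?E)"
        by (intro mult_left_mono V) auto
      also have "\<dots> = 32 * (real CARD('d))\<^sup>2 * ((\<gamma> k)\<^sup>2 * real (n k) ^ p) * ?E"
        by (simp add: power2_eq_square mult_ac)
      also have "\<dots> = 32 / 36 * ?E"
        unfolding \<gamma>2 by (simp add: \<epsilon>_def power_divide power_mult_distrib)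
      also have "\<dots> \<le> ?E" using dirichlet_energy_nonneg[of "shell k" v] by simp
      finally show ?thesis .
    next
      case False
      \<comment> \<open>For \<open>n k = 0\<close> the quotient in \<open>\<gamma>\<close> is a
        division by zero, which equals 0.\<close>
      then have "\<gamma> k = 0" using p by (auto simp: \<gamma>_def)
      then show ?thesis by (simp add: dirichlet_energy_nonneg)
    qed
  qed (use visit_prob_outside visit_prob_self[OF y] visit_prob_harmonic[of _ \<Lambda> y] \<gamma>0 \<gamma>1 diff slope_le
       in \<open>simp_all add: visit_prob_def\<close>)
  \<comment> \<open>The constant is at least 1, so it may be squared to make the bound a perfect
    square.\<close>
  also have "\<dots> \<le> (16 * CARD('d) * card \<Lambda>)\<^sup>2 * exp (- 2 * shell_weight p \<epsilon> K n (sup_norm y))"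
  proof -
    have "0 < card \<Lambda>" using fin y card_gt_0_iff by blast
    then have "1 \<le> CARD('d) * card \<Lambda>" by (simp add: Suc_le_eq)
    then have "1 \<le> real (16 * CARD('d) * card \<Lambda>)" by linarith
    then have "real (16 * CARD('d) * card \<Lambda>) \<le> (real (16 * CARD('d) * card \<Lambda>))\<^sup>2"
      by (intro self_le_power) auto
    then show ?thesis using x by (simp add: shell_weight_eq_0)
  qed
  also have "\<dots> = ((16 * CARD('d) * card \<Lambda>) * exp (- shell_weight p \<epsilon> K n (sup_norm y)))\<^sup>2"
    by (simp add: power_mult_distrib flip: exp_of_nat_mult)
  finally show ?thesis unfolding \<epsilon>_def by (rule power2_le_imp_le) auto
qed

text \<open>The 1 added to the prefactor ensures \<open>C \<ge> 1\<close> also for an empty list.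
  The 48 is the 8 of the weight bound times the 6 of the slope constant.\<close>

lemma idla_origin_bound:
  fixes xs :: "(int ^ 'd) list" and K L p :: nat and \<rho> :: real
  defines "N \<equiv> length xs" and "\<rho> \<equiv> 2 / sqrt (2 ^ p)"
  assumes p: "p = 2 \<and> CARD('d) \<ge> 2 \<or> p = 1 \<and> CARD('d) \<ge> 3"
    and K: "1 \<le> K" and start: "\<And>x. x \<in> set xs \<Longrightarrow> 2 * K \<le> sup_norm x"
    and N: "2 * N \<le> K\<^sup>2" and L: "2 * K < 2 ^ L"
  shows "measure walks {\<omega> \<in> space walks. 0 \<in> idla_cluster xs \<omega>}
    \<le> real ((2 * N + 1) ^ CARD('d) + 1) ^ N * real (16 * CARD('d) * N + 1) ^ N *
      exp (- (1 / (48 * real CARD('d)) * (K\<^sup>2 / (4 * (\<Sum>l<L. inverse \<rho> ^ l)) - \<rho> ^ L * K)))"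
  unfolding N_def
proof (rule idla_origin_union_bound[where R = "2 * K"])
  fix \<Lambda> :: "(int ^ 'd) set"
  assume fin: "finite \<Lambda>" and card: "card \<Lambda> \<le> length xs" and full: "{..2 * K} \<subseteq> sup_norm ` \<Lambda>"
  define n where "n k = card (\<Lambda> \<inter> shell k)" for k
  let ?\<epsilon> = "1 / (6 * real CARD('d))"
  let ?S = "\<lambda>y. shell_weight p ?\<epsilon> K n (sup_norm y)"
  have n1: "1 \<le> n k" if "k \<le> 2 * K" for k
  proof -
    have "k \<in> sup_norm ` \<Lambda>" using full that by auto
    then have "\<Lambda> \<inter> shell k \<noteq> {}" by (auto simp: shell_def)
    then show ?thesis using fin by (simp add: n_def Suc_le_eq card_gt_0_iff)
  qed
  have shell_sum: "(\<Sum>k\<in>I. n k * g k) \<le> (\<Sum>y\<in>\<Lambda>. g (sup_norm y))"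
    if "finite I" "\<And>k. 0 \<le> g k" for I and g :: "nat \<Rightarrow> real"
  proof -
    have "(\<Sum>k\<in>I. n k * g k) = (\<Sum>k\<in>I. \<Sum>y\<in>\<Lambda> \<inter> shell k. g (sup_norm y))"
      by (auto simp: n_def shell_def intro!: sum.cong)
    also have "\<dots> = (\<Sum>y\<in>(\<Union>k\<in>I. \<Lambda> \<inter> shell k). g (sup_norm y))"
      using that fin by (intro sum.UNION_disjoint[symmetric]) (auto simp: shell_def)
    also have "\<dots> \<le> (\<Sum>y\<in>\<Lambda>. g (sup_norm y))"
      using fin that by (intro sum_mono2) auto
    finally show ?thesis .
  qed
  have "real (\<Sum>k\<in>{K..2 * K}. n k) \<le> real (card \<Lambda>)"
    using shell_sum[of "{K..2 * K}" "\<lambda>_. 1"] by simp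
  then have "(\<Sum>k\<in>{K..2 * K}. n k) \<le> N" using card unfolding N_def by linarith
  then have "?\<epsilon> / 8 * (K\<^sup>2 / (4 * (\<Sum>l<L. inverse \<rho> ^ l)) - \<rho> ^ L * K) \<le> (\<Sum>k\<in>{K..<2 * K}. n k * shell_weight p ?\<epsilon> K n k)"
    unfolding \<rho>_def using p K n1 N L by (intro total_shell_weight_ge) auto
  also have "\<dots> \<le> (\<Sum>y\<in>\<Lambda>. ?S y)"
    by (intro shell_sum) (auto intro: shell_weight_nonneg)
  finally have D: "1 / (48 * real CARD('d)) * (K\<^sup>2 / (4 * (\<Sum>l<L. inverse \<rho> ^ l)) - \<rho> ^ L * K) \<le> (\<Sum>y\<in>\<Lambda>. ?S y)"
    by simp
  have "visit_prob \<Lambda> y x \<le> (16 * CARD('d) * length xs + 1) * exp (- ?S y)" if "y \<in> \<Lambda>" "x \<in> set xs" for y x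
  proof -
    have "visit_prob \<Lambda> y x \<le> real (16 * CARD('d) * card \<Lambda>) * exp (- ?S y)"
      using visit_prob_decay[OF p fin n1[unfolded n_def] that(1) start[OF that(2)]]
      unfolding n_def by simp
    also have "\<dots> \<le> real (16 * CARD('d) * length xs + 1) * exp (- ?S y)"
      using card by (intro mult_right_mono) (simp_all only: of_nat_le_iff exp_ge_zero, simp add: le_SucI)
    finally show ?thesis by simp
  qed
  then show "\<exists>S. (\<forall>y\<in>\<Lambda>. \<forall>x\<in>set xs. visit_prob \<Lambda> y x \<le> real (16 * CARD('d) * length xs + 1) * exp (- S y)) \<and>
      1 / (48 * real CARD('d)) * (K\<^sup>2 / (4 * (\<Sum>l<L. inverse \<rho> ^ l)) - \<rho> ^ L * K) \<le> (\<Sum>y\<in>\<Lambda>. S y)"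
    using D by (intro exI[of _ ?S]) auto
qed (use start in auto)

section \<open>From Euclidean balls to cubes, and the choice of constants\<close>

lemma norm_lattice_embed_le: "norm (lattice_embed z) \<le> sqrt CARD('d) * sup_norm z" for z :: "int ^ 'd"
proof -
  have "(norm (lattice_embed z))\<^sup>2 = (\<Sum>i\<in>UNIV. (real_of_int (z $ i))\<^sup>2)"
    by (simp add: norm_vec_def L2_set_def lattice_embed_def sum_nonneg)
  also have "\<dots> \<le> (\<Sum>i\<in>(UNIV :: 'd set). (real (sup_norm z))\<^sup>2)"
  proof (intro sum_mono)
    fix i
    have "\<bar>real_of_int (z $ i)\<bar> \<le> real (sup_norm z)" using abs_le_sup_norm[of z i] by linarith
    then show "(real_of_int (z $ i))\<^sup>2 \<le> (real (sup_norm z))\<^sup>2"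
      using abs_le_square_iff[of "real_of_int (z $ i)" "real (sup_norm z)"] by simp
  qed
  also have "\<dots> = (sqrt CARD('d) * sup_norm z)\<^sup>2" by (simp add: power_mult_distrib)
  finally show ?thesis by (rule power2_le_imp_le) auto
qed

lemma walk_ordering_length:
  assumes "finite_config \<eta>" "walk_ordering \<eta> xs"
  shows "length xs = config_size \<eta>" and "\<And>x. x \<in> set xs \<Longrightarrow> \<eta> x \<noteq> 0"
proof -
  show *: "\<eta> x \<noteq> 0" if "x \<in> set xs" for x
    using that assms by (metis count_list_0_iff walk_ordering_def)
  have "sum (count_list xs) {z. \<eta> z \<noteq> 0} = length xs"
    using assms * by (intro sum_count_set) (auto simp: finite_config_def)
  then show "length xs = config_size \<eta>"
    using assms by (simp add: config_size_def walk_ordering_def)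
qed

text \<open>Dividing by \<open>sqrt c\<close> turns a Euclidean radius into a sup-norm radius. The
  quotient is at least 2, so rounding loses at most half of it.\<close>

lemma radius_floor:
  fixes c r :: real
  assumes "1 \<le> c" "2 * sqrt c \<le> r"
  defines "K \<equiv> nat \<lfloor>r / sqrt c\<rfloor>"
  shows "1 \<le> K" "real K \<le> r / sqrt c" "real K \<le> r" "r\<^sup>2 / (4 * c) \<le> (real K)\<^sup>2"
proof -
  have c: "1 \<le> sqrt c" using assms by simp
  have r: "2 \<le> r / sqrt c" using assms c by (simp add: le_divide_eq)
  then have K: "real K \<le> r / sqrt c" "r / sqrt c - 1 < real K"
    unfolding K_def by linarith+
  then show "1 \<le> K" "real K \<le> r / sqrt c" using r by linarith+
  have "0 \<le> r" using assms(2) c by linarith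
  then have "r / sqrt c \<le> r / 1" using c by (intro divide_left_mono) auto
  then show "real K \<le> r" using K by simp
  have "q / 2 \<le> real K" if "q - 1 < real K" "2 \<le> q" for q using that by linarith
  from this[OF K(2) r] have "(r / sqrt c / 2)\<^sup>2 \<le> (real K)\<^sup>2" using \<open>0 \<le> r\<close> c by (intro power_mono) auto
  then show "r\<^sup>2 / (4 * c) \<le> (real K)\<^sup>2" using assms by (simp add: power_divide mult.commute)
qed

text \<open>\<open>\<phi>\<close> is the order of the final exponent. Assignments and prefactors
  cost at most \<open>(r^3)^(c + 1)\<close> per walk, altogether at most
  \<open>exp (\<kappa> * \<phi>)\<close>, against the gain
  \<open>exp (- 2 * \<kappa> * \<phi>)\<close>.\<close>

lemma idla_origin_exp_bound:
  fixes \<eta> :: "int ^ 'd \<Rightarrow> nat" and r \<phi> \<kappa> \<rho> :: real and L p :: nat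
  defines "c \<equiv> CARD('d)"
  defines "K \<equiv> nat \<lfloor>r / sqrt c\<rfloor>" and "\<rho> \<equiv> 2 / sqrt (2 ^ p)"
  assumes p: "p = 2 \<and> c \<ge> 2 \<or> p = 1 \<and> c \<ge> 3"
    and \<eta>: "finite_config \<eta>" "\<forall>z \<in> lattice_ball 0 (2 * r). \<eta> z = 0" "walk_ordering \<eta> xs"
    and r: "2 * sqrt c \<le> r" "4 * r\<^sup>2 + 2 \<le> r ^ 3" "16 * c * r\<^sup>2 + 1 \<le> r ^ 3"
    and N: "config_size \<eta> \<le> r\<^sup>2 / (8 * c)" "config_size \<eta> * ln r \<le> \<kappa> * \<phi> / (3 * c + 3)"
    and L: "2 * K < 2 ^ L"
    and D: "2 * \<kappa> * \<phi> \<le> 1 / (48 * real c) * (K\<^sup>2 / (4 * (\<Sum>l<L. inverse \<rho> ^ l)) - \<rho> ^ L * K)"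
  shows "measure walks {\<omega> \<in> space walks. 0 \<in> idla_cluster xs \<omega>} \<le> exp (- \<kappa> * \<phi>)"
proof -
  let ?N = "length xs"
  have c: "1 \<le> real c" by (simp add: c_def Suc_le_eq)
  have len: "?N = config_size \<eta>" by (rule walk_ordering_length) fact+
  note K = radius_floor[OF c r(1), folded K_def]
  have r1: "1 \<le> r" using r(1) c real_sqrt_ge_one[OF c] by linarith
  have start: "2 * K \<le> sup_norm x" if "x \<in> set xs" for x
  proof -
    have "\<eta> x \<noteq> 0" using walk_ordering_length(2)[OF \<eta>(1,3) that] .
    then have "x \<notin> lattice_ball 0 (2 * r)" using \<eta>(2) by auto
    then have "2 * r \<le> norm (lattice_embed x)" by (simp add: lattice_ball_def)
    then have "2 * r \<le> sqrt c * sup_norm x"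
      using norm_lattice_embed_le[of x] by (simp add: c_def)
    then have "2 * (r / sqrt c) \<le> real (sup_norm x)"
      using c by (simp add: divide_le_eq mult.commute)
    then have "real (2 * K) \<le> real (sup_norm x)" using K(2) by simp
    then show ?thesis by (simp only: of_nat_le_iff)
  qed
  have "real (2 * ?N) \<le> r\<^sup>2 / (4 * c)" using N(1) by (simp add: len field_simps)
  also have "\<dots> \<le> real (K\<^sup>2)" using K(4) by simp
  finally have NK: "2 * ?N \<le> K\<^sup>2" by (simp only: of_nat_le_iff)
  have "r\<^sup>2 / (8 * c) \<le> r\<^sup>2 / 1" using c by (intro divide_left_mono) auto
  then have Nr: "real ?N \<le> r\<^sup>2" using N(1) len by simp
  have "real ((2 * ?N + 1) ^ c + 1) = (2 * real ?N + 1) ^ c + 1"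
    by (simp add: add.commute)
  also have "\<dots> \<le> 2 * (2 * real ?N + 1) ^ c" by simp
  also have "\<dots> \<le> 2 ^ c * (2 * real ?N + 1) ^ c"
    using c self_le_power[of "2::real" c] by (intro mult_right_mono) (auto simp: Suc_le_eq)
  also have "\<dots> = (4 * real ?N + 2) ^ c" by (simp only: power_mult_distrib[symmetric]) (simp add: distrib_left)
  also have "\<dots> \<le> (r ^ 3) ^ c" using Nr r(2) by (intro power_mono) auto
  finally have count: "real ((2 * ?N + 1) ^ c + 1) \<le> (r ^ 3) ^ c" .
  have "real (16 * c * ?N + 1) \<le> 16 * c * r\<^sup>2 + 1" using Nr by (simp add: mult_left_mono)
  also have "\<dots> \<le> r ^ 3" using r(3) by simp
  finally have const: "real (16 * c * ?N + 1) \<le> r ^ 3" .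
  have "measure walks {\<omega> \<in> space walks. 0 \<in> idla_cluster xs \<omega>}
    \<le> real ((2 * ?N + 1) ^ c + 1) ^ ?N * real (16 * c * ?N + 1) ^ ?N *
      exp (- (1 / (48 * real c) * (K\<^sup>2 / (4 * (\<Sum>l<L. inverse \<rho> ^ l)) - \<rho> ^ L * K)))"
    unfolding c_def \<rho>_def
    using idla_origin_bound[of p K xs L, OF p[unfolded c_def] K(1) start NK L] by simp
  also have "\<dots> \<le> ((r ^ 3) ^ c) ^ ?N * (r ^ 3) ^ ?N * exp (- (2 * \<kappa> * \<phi>))"
    using D r1 by (intro mult_mono power_mono count const) auto
  also have "((r ^ 3) ^ c) ^ ?N * (r ^ 3) ^ ?N = r ^ ((3 * c + 3) * ?N)"
    by (simp add: power_mult[symmetric] power_add[symmetric] algebra_simps)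
  also have "\<dots> = exp ((3 * c + 3) * (?N * ln r))"
    using r1 exp_of_nat_mult[of "(3 * c + 3) * ?N" "ln r"] by (simp add: mult.assoc)
  also have "exp ((3 * c + 3) * (?N * ln r)) * exp (- (2 * \<kappa> * \<phi>)) \<le> exp (\<kappa> * \<phi>) * exp (- (2 * \<kappa> * \<phi>))"
  proof -
    have "(?N * ln r) * (3 * c + 3) \<le> \<kappa> * \<phi>" using N(2) by (simp add: len pos_le_divide_eq)
    then show ?thesis by (simp add: mult.commute)
  qed
  also have "\<dots> = exp (- \<kappa> * \<phi>)" by (simp flip: exp_add)
  finally show ?thesis .
qed

text \<open>All pair counts up to \<open>2 * K\<close> fall into the first \<open>L\<close> dyadic
  classes, and \<open>2^L\<close> is still of order \<open>K\<close>.\<close>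

lemma dyadic_bracket:
  fixes K :: nat
  assumes "1 \<le> K" obtains L where "2 * K < 2 ^ L" "2 ^ L \<le> 4 * K" "1 \<le> L"
proof -
  obtain n where "2 ^ n \<le> 2 * K \<and> 2 * K < 2 ^ (n + 1)"
    using ex_power_ivl1[of 2 "2 * K"] assms by auto
  then show thesis using that[of "n + 1"] by simp
qed

text \<open>For \<open>p = 2\<close> the ratio \<open>\<rho>\<close> is 1. The sum of inverse
  weights is then \<open>L\<close>, of order \<open>ln r\<close>, which is the loss in the exponent,
  and the subtracted term is only \<open>K\<close>.\<close>

lemma idla_origin_planar:
  assumes d: "CARD('d::finite) = 2"
  shows "\<exists>a > 0. \<exists>\<kappa> > 0. \<forall>\<^sub>F r in (at_top :: real filter).
        \<forall>(\<eta> :: int ^ 'd \<Rightarrow> nat) xs.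
          finite_config \<eta> \<longrightarrow>
          (\<forall>z \<in> lattice_ball 0 (2 * r). \<eta> z = 0) \<longrightarrow>
          real (config_size \<eta>) \<le> a * r\<^sup>2 / (ln r)\<^sup>2 \<longrightarrow>
          walk_ordering \<eta> xs \<longrightarrow>
          measure walks {\<omega> \<in> space walks. 0 \<in> idla_cluster xs \<omega>}
            \<le> exp (- \<kappa> * (r\<^sup>2 / ln r))"
proof -
  define c where "c = CARD('d)"
  have c2: "c = 2" using d by (simp add: c_def)
  \<comment> \<open>With \<open>c = 2\<close>, \<open>2 * \<kappa>\<close> is
    \<open>1 / (48 * c)\<close> times the \<open>1 / 128\<close> reached below. The denominator of
    \<open>a\<close> pays for the counting.\<close>
  define \<kappa> :: real where "\<kappa> = 1 / (6144 * c\<^sup>2)"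
  define a where "a = \<kappa> / (3 * c + 3)"
  have "\<forall>\<^sub>F r in (at_top :: real filter).
     2 * sqrt 2 \<le> r \<and> 4 * r\<^sup>2 + 2 \<le> r ^ 3 \<and> 32 * r\<^sup>2 + 1 \<le> r ^ 3 \<and>
     2 \<le> ln r \<and> 384 * (r * ln r) \<le> r\<^sup>2"
    by (intro eventually_conj) real_asymp+
  then have "\<forall>\<^sub>F r in (at_top :: real filter).
        \<forall>(\<eta> :: int ^ 'd \<Rightarrow> nat) xs.
          finite_config \<eta> \<longrightarrow>
          (\<forall>z \<in> lattice_ball 0 (2 * r). \<eta> z = 0) \<longrightarrow>
          real (config_size \<eta>) \<le> a * r\<^sup>2 / (ln r)\<^sup>2 \<longrightarrow>
          walk_ordering \<eta> xs \<longrightarrow>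
          measure walks {\<omega> \<in> space walks. 0 \<in> idla_cluster xs \<omega>}
            \<le> exp (- \<kappa> * (r\<^sup>2 / ln r))"
  proof (rule eventually_mono, intro allI impI)
    fix r :: real and \<eta> :: "int ^ 'd \<Rightarrow> nat" and xs
    assume r: "2 * sqrt 2 \<le> r \<and> 4 * r\<^sup>2 + 2 \<le> r ^ 3 \<and> 32 * r\<^sup>2 + 1 \<le> r ^ 3 \<and>
        2 \<le> ln r \<and> 384 * (r * ln r) \<le> r\<^sup>2"
      and \<eta>: "finite_config \<eta>" "\<forall>z \<in> lattice_ball 0 (2 * r). \<eta> z = 0" "walk_ordering \<eta> xs"
      and size: "real (config_size \<eta>) \<le> a * r\<^sup>2 / (ln r)\<^sup>2"
    define K where "K = nat \<lfloor>r / sqrt c\<rfloor>"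
    have rc: "2 * sqrt c \<le> r" using r by (simp add: c2)
    note K = radius_floor[OF _ rc, folded K_def, unfolded c2, simplified]
    obtain L where L: "2 * K < 2 ^ L" "2 ^ L \<le> 4 * K" "1 \<le> L" using dyadic_bracket[of K] K(1) by auto
    have r1: "1 \<le> r" using K(1,3) by linarith
    have "real (2 ^ L) \<le> real (4 * K)" using L(2) by (simp only: of_nat_le_iff)
    then have "ln (2 ^ L) \<le> ln (4 * r)" using K(3) r1 by (subst ln_le_cancel_iff) auto
    then have "L * ln 2 \<le> 2 * ln 2 + ln r"
      using r1 ln_realpow[of 2 2] by (simp add: ln_realpow ln_mult)
    moreover have "(real L - 2) * (1 / 2) \<le> (real L - 2) * ln 2" if "2 \<le> L"
      using ln2_ge_two_thirds that by (intro mult_left_mono) auto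
    ultimately have "real L \<le> 2 + 2 * ln r"
      using r by (cases "2 \<le> L") (auto simp: algebra_simps)
    then have L_le: "real L \<le> 3 * ln r" using r by linarith
    have "r\<^sup>2 / (96 * ln r) = (r\<^sup>2 / 8) / (4 * (3 * ln r))" by simp
    also have "\<dots> \<le> (r\<^sup>2 / 8) / (4 * L)"
      using L_le L(3) r by (intro divide_left_mono) auto
    also have "\<dots> \<le> K\<^sup>2 / (4 * L)" using K(4) by (intro divide_right_mono) auto
    finally have "r\<^sup>2 / (96 * ln r) \<le> K\<^sup>2 / (4 * L)" .
    moreover have "r \<le> r\<^sup>2 / (384 * ln r)" using r by (simp add: le_divide_eq mult_ac)
    moreover have "r\<^sup>2 / (128 * ln r) = r\<^sup>2 / (96 * ln r) - r\<^sup>2 / (384 * ln r)"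
      using r by (simp add: field_simps)
    ultimately have "r\<^sup>2 / (128 * ln r) \<le> K\<^sup>2 / (4 * L) - K" using K(3) by linarith
    then have D: "2 * \<kappa> * (r\<^sup>2 / ln r) \<le> 1 / (48 * real c) * (K\<^sup>2 / (4 * (\<Sum>l<L. inverse (2 / sqrt (2 ^ 2)) ^ l))
        - (2 / sqrt (2 ^ 2)) ^ L * K)"
      by (simp add: \<kappa>_def c2 field_simps)
    have "real (config_size \<eta>) * ln r \<le> a * r\<^sup>2 / (ln r)\<^sup>2 * ln r"
      using size r by (intro mult_right_mono) auto
    also have "\<dots> = \<kappa> * (r\<^sup>2 / ln r) / (3 * c + 3)" using r by (simp add: a_def power2_eq_square)
    finally have N2: "real (config_size \<eta>) * ln r \<le> \<kappa> * (r\<^sup>2 / ln r) / (3 * c + 3)" .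
    have "a * r\<^sup>2 / (ln r)\<^sup>2 \<le> a * r\<^sup>2 / 1"
      using r by (intro divide_left_mono) (auto simp: a_def \<kappa>_def)
    also have "\<dots> \<le> r\<^sup>2 / (8 * c)" by (simp add: a_def \<kappa>_def c2)
    finally have N1: "real (config_size \<eta>) \<le> r\<^sup>2 / (8 * c)" using size by linarith
    show "measure walks {\<omega> \<in> space walks. 0 \<in> idla_cluster xs \<omega>} \<le> exp (- \<kappa> * (r\<^sup>2 / ln r))"
      by (rule idla_origin_exp_bound[where p = 2 and L = L])
         (use \<eta> r rc N1 N2 L(1) D in \<open>simp_all add: K_def flip: c_def, simp_all add: c2\<close>)
  qed
  moreover have "0 < \<kappa>" "0 < a" by (simp_all add: \<kappa>_def a_def c2)
  ultimately show ?thesis by blast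
qed

text \<open>For \<open>p = 1\<close> the ratio \<open>\<rho>\<close> is \<open>sqrt 2\<close>. The
  inverse weights form a convergent geometric series, so no logarithm is lost, and
  \<open>\<rho>^L * K\<close> is at most of order \<open>r * sqrt r\<close>.\<close>

lemma idla_origin_high_dimension:
  assumes d: "CARD('d::finite) \<ge> 3"
  shows "\<exists>a > 0. \<exists>\<kappa> > 0. \<forall>\<^sub>F r in (at_top :: real filter).
        \<forall>(\<eta> :: int ^ 'd \<Rightarrow> nat) xs.
          finite_config \<eta> \<longrightarrow>
          (\<forall>z \<in> lattice_ball 0 (2 * r). \<eta> z = 0) \<longrightarrow>
          real (config_size \<eta>) \<le> a * r\<^sup>2 / ln r \<longrightarrow>
          walk_ordering \<eta> xs \<longrightarrow>
          measure walks {\<omega> \<in> space walks. 0 \<in> idla_cluster xs \<omega>}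
            \<le> exp (- \<kappa> * r\<^sup>2)"
proof -
  define c where "c = CARD('d)"
  have c3: "3 \<le> c" using d by (simp add: c_def)
  then have c1: "1 \<le> real c" "0 < real c" by linarith+
  \<comment> \<open>Here \<open>2 * \<kappa>\<close> is \<open>1 / (48 * c)\<close> times the
    \<open>1 / (128 * c)\<close> reached below.\<close>
  define \<kappa> :: real where "\<kappa> = 1 / (12288 * c\<^sup>2)"
  define a where "a = \<kappa> / (3 * c + 3)"
  have ev: "\<forall>\<^sub>F r in (at_top :: real filter).
     2 * sqrt (real c) \<le> r \<and> 4 * r\<^sup>2 + 2 \<le> r ^ 3 \<and> 16 * real c * r\<^sup>2 + 1 \<le> r ^ 3 \<and> 1 \<le> ln r \<and>
     r\<^sup>2 / (128 * real c) \<le> r\<^sup>2 / (64 * real c) - 2 * sqrt r * r"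
    using c1 by (intro eventually_conj) real_asymp+
  have "\<forall>\<^sub>F r in (at_top :: real filter).
        \<forall>(\<eta> :: int ^ 'd \<Rightarrow> nat) xs.
          finite_config \<eta> \<longrightarrow>
          (\<forall>z \<in> lattice_ball 0 (2 * r). \<eta> z = 0) \<longrightarrow>
          real (config_size \<eta>) \<le> a * r\<^sup>2 / ln r \<longrightarrow>
          walk_ordering \<eta> xs \<longrightarrow>
          measure walks {\<omega> \<in> space walks. 0 \<in> idla_cluster xs \<omega>}
            \<le> exp (- \<kappa> * r\<^sup>2)"
    using ev
  proof (rule eventually_mono, intro allI impI)
    fix r :: real and \<eta> :: "int ^ 'd \<Rightarrow> nat" and xs
    assume r: "2 * sqrt (real c) \<le> r \<and> 4 * r\<^sup>2 + 2 \<le> r ^ 3 \<and> 16 * real c * r\<^sup>2 + 1 \<le> r ^ 3 \<and> 1 \<le> ln r \<and>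
        r\<^sup>2 / (128 * real c) \<le> r\<^sup>2 / (64 * real c) - 2 * sqrt r * r"
      and \<eta>: "finite_config \<eta>" "\<forall>z \<in> lattice_ball 0 (2 * r). \<eta> z = 0" "walk_ordering \<eta> xs"
      and size: "real (config_size \<eta>) \<le> a * r\<^sup>2 / ln r"
    define K where "K = nat \<lfloor>r / sqrt c\<rfloor>"
    have rc: "2 * sqrt c \<le> r" using r by simp
    note K = radius_floor[OF c1(1) rc, folded K_def]
    obtain L where L: "2 * K < 2 ^ L" "2 ^ L \<le> 4 * K" "1 \<le> L" using dyadic_bracket[of K] K(1) by auto
    let ?Z = "\<Sum>l<L. inverse (2 / sqrt (2 ^ 1)) ^ l :: real"
    \<comment> \<open>This rational bound gives the ratio \<open>3 / 4\<close>, whose geometric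
      series has sum 4.\<close>
    have sqrt2: "4 / 3 \<le> sqrt 2"
      by (rule real_le_rsqrt) (simp add: power2_eq_square)
    have root: "2 / sqrt (2 ^ 1) = sqrt (2::real)" by (simp add: real_div_sqrt)
    have q: "inverse (sqrt 2) \<le> (3 / 4 :: real)" "0 < inverse (sqrt (2 :: real))"
      using sqrt2 root by (simp_all add: field_simps)
    have "?Z \<le> (\<Sum>l<L. (3 / 4) ^ l)" unfolding root using q by (intro sum_mono power_mono) auto
    also have "\<dots> \<le> (\<Sum>l. (3 / 4) ^ l)" by (intro sum_le_suminf summable_geometric) auto
    also have "\<dots> = 4" by (subst suminf_geometric) auto
    finally have Z4: "?Z \<le> 4" .
    have Z0: "0 < ?Z" unfolding root using q L(3) by (intro sum_pos zero_less_power) (auto simp: Suc_le_eq)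
    have r1: "1 \<le> r" using K(1,3) by linarith
    have "real (2 ^ L) \<le> real (4 * K)" using L(2) by (simp only: of_nat_le_iff)
    then have "(2::real) ^ L \<le> 4 * r" using K(3) by simp
    then have "sqrt (2 ^ L) \<le> sqrt (4 * r)" by simp
    then have "sqrt 2 ^ L \<le> 2 * sqrt r" by (simp add: real_sqrt_power real_sqrt_mult)
    then have rhoL: "sqrt 2 ^ L * K \<le> 2 * sqrt r * r" using K(3) r1 by (intro mult_mono) auto
    have "r\<^sup>2 / (64 * c) = r\<^sup>2 / (4 * c) / (4 * 4)" by simp
    also have "\<dots> \<le> (real K)\<^sup>2 / (4 * 4)" using K(4) by (intro divide_right_mono) auto
    also have "\<dots> \<le> (real K)\<^sup>2 / (4 * ?Z)" using Z4 Z0 by (intro divide_left_mono) auto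
    finally have "r\<^sup>2 / (128 * c) \<le> K\<^sup>2 / (4 * ?Z) - (2 / sqrt (2 ^ 1)) ^ L * K"
      using r rhoL unfolding root by simp
    then have "1 / (48 * real c) * (r\<^sup>2 / (128 * c))
        \<le> 1 / (48 * real c) * (K\<^sup>2 / (4 * ?Z) - (2 / sqrt (2 ^ 1)) ^ L * K)"
      by (intro mult_left_mono) auto
    moreover have "2 * \<kappa> * r\<^sup>2 = 1 / (48 * real c) * (r\<^sup>2 / (128 * c))"
      by (simp add: \<kappa>_def power2_eq_square)
    ultimately have D: "2 * \<kappa> * r\<^sup>2 \<le> 1 / (48 * real c) * (K\<^sup>2 / (4 * ?Z) - (2 / sqrt (2 ^ 1)) ^ L * K)"
      by linarith
    have "real (config_size \<eta>) * ln r \<le> a * r\<^sup>2 / ln r * ln r"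
      using size r by (intro mult_right_mono) auto
    also have "\<dots> = \<kappa> * r\<^sup>2 / (3 * c + 3)" using r by (simp add: a_def)
    finally have N2: "real (config_size \<eta>) * ln r \<le> \<kappa> * r\<^sup>2 / (3 * c + 3)" .
    have "a \<le> \<kappa> / 1" unfolding a_def by (intro divide_left_mono) (auto simp: \<kappa>_def)
    also have "\<dots> \<le> 1 / (8 * c)"
      using c1 by (simp add: \<kappa>_def power2_eq_square divide_simps)
    finally have a: "a \<le> 1 / (8 * c)" .
    have "a * r\<^sup>2 / ln r \<le> a * r\<^sup>2 / 1"
      using r by (intro divide_left_mono) (auto simp: a_def \<kappa>_def)
    also have "\<dots> \<le> r\<^sup>2 / (8 * c)" using mult_right_mono[OF a, of "r\<^sup>2"] by simp
    finally have N1: "real (config_size \<eta>) \<le> r\<^sup>2 / (8 * c)" using size by linarith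
    show "measure walks {\<omega> \<in> space walks. 0 \<in> idla_cluster xs \<omega>} \<le> exp (- \<kappa> * r\<^sup>2)"
      by (rule idla_origin_exp_bound[where p = 1 and L = L])
         (use \<eta> r rc N1 N2 L(1) D c3 in \<open>simp_all only: K_def c_def, simp_all\<close>)
  qed
  moreover have "0 < \<kappa>" "0 < a" using c1 by (simp_all add: \<kappa>_def a_def)
  ultimately show ?thesis by blast
qed

theorem lemma1p2:
  shows "(CARD('d::finite) = 2 \<longrightarrow>
      (\<exists>a > 0. \<exists>\<kappa> > 0. \<forall>\<^sub>F r in (at_top :: real filter).
        \<forall>(\<eta> :: int ^ 'd \<Rightarrow> nat) xs.
          finite_config \<eta> \<longrightarrow>
          (\<forall>z \<in> lattice_ball 0 (2 * r). \<eta> z = 0) \<longrightarrow>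
          real (config_size \<eta>) \<le> a * r\<^sup>2 / (ln r)\<^sup>2 \<longrightarrow>
          walk_ordering \<eta> xs \<longrightarrow>
          measure walks {\<omega> \<in> space walks. 0 \<in> idla_cluster xs \<omega>}
            \<le> exp (- \<kappa> * (r\<^sup>2 / ln r))))
    \<and>
    (CARD('d) \<ge> 3 \<longrightarrow>
      (\<exists>a > 0. \<exists>\<kappa> > 0. \<forall>\<^sub>F r in (at_top :: real filter).
        \<forall>(\<eta> :: int ^ 'd \<Rightarrow> nat) xs.
          finite_config \<eta> \<longrightarrow>
          (\<forall>z \<in> lattice_ball 0 (2 * r). \<eta> z = 0) \<longrightarrow>
          real (config_size \<eta>) \<le> a * r\<^sup>2 / ln r \<longrightarrow>
          walk_ordering \<eta> xs \<longrightarrow>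
          measure walks {\<omega> \<in> space walks. 0 \<in> idla_cluster xs \<omega>}
            \<le> exp (- \<kappa> * r\<^sup>2)))"
  using idla_origin_planar idla_origin_high_dimension by blast

end
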